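(* Let $R$ be a ring with zero characteristic which is not submaximal. Then $\{\mathrm{Char}(R/M)\mid M\in \mathrm{Max}(R)\}=\mathbb{P}$, and therefore $|\mathrm{Max}(R)|$ is infinite.
   Context: All rings are commutative with $1\neq 0$, and a subring of a ring contains the identity of that ring. A maximal subring of $R$ is a proper subring $S\subsetneq R$ such that there is no subring strictly between $S$ and $R$; $R$ is called submaximal if it has at least one maximal subring. $\mathrm{Max}(R)$ is the set of maximal ideals of $R$, $\mathrm{Char}$ denotes the characteristic, and $\mathbb{P}$ is the set of all prime numbers. *)

theory Defs
  imports "HOL-Algebra.Algebra" "HOL-Computational_Algebra.Primes"
begin

text \<open>Rings in the sense considered here: commutative and nonzero.\<close>

locale nonzero_cring = cring +
  assumes one_neq_zero: "\<one> \<noteq> \<zero>"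

definition ring_char :: "('a, 'b) ring_scheme \<Rightarrow> nat" where
  "ring_char R =
     (if \<exists>n::nat. 0 < n \<and> [n] \<cdot>\<^bsub>R\<^esub> \<one>\<^bsub>R\<^esub> = \<zero>\<^bsub>R\<^esub>
      then (LEAST n::nat. 0 < n \<and> [n] \<cdot>\<^bsub>R\<^esub> \<one>\<^bsub>R\<^esub> = \<zero>\<^bsub>R\<^esub>) else 0)"

definition max_ideals :: "('a, 'b) ring_scheme \<Rightarrow> 'a set set" where
  "max_ideals R = {M. maximalideal M R}"

definition maximal_subring :: "'a set \<Rightarrow> ('a, 'b) ring_scheme \<Rightarrow> bool" where
  "maximal_subring S R \<longleftrightarrow>
     subring S R \<and> S \<subset> carrier R \<and> (\<nexists>T. subring T R \<and> S \<subset> T \<and> T \<subset> carrier R)"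

definition submaximal :: "('a, 'b) ring_scheme \<Rightarrow> bool" where
  "submaximal R \<longleftrightarrow> (\<exists>S. maximal_subring S R)"

end

theory Submission
  imports Defs
begin

text \<open>
  The key fact is that every field \<open>E\<close> of characteristic zero has, for each prime \<open>p\<close>, a subring
  \<open>T\<close> with \<open>1/p \<notin> T\<close> and \<open>E = T[1/p]\<close>. Apply Zorn's lemma to the subrings \<open>T\<close> of \<open>E\<close> for which
  \<open>T[1/p]\<close> is a field not equal to \<open>T\<close>. A maximal such \<open>T\<close> is a valuation ring of \<open>F = T[1/p]\<close>,
  and \<open>F = E\<close>: an algebraic element outside \<open>F\<close> can be scaled by a power of \<open>p\<close> to become integral
  over \<open>T\<close> and then adjoined, and for a transcendental element the Gauss extension of the valuation
  enlarges \<open>T\<close>.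

  Hence \<open>R\<close> is submaximal as soon as it has a homomorphism \<open>h\<close> to such a field with \<open>1/p\<close> in its
  image: the preimage of \<open>T\<close> and a preimage of \<open>1/p\<close> generate \<open>R\<close>. If \<open>R\<close> is not submaximal, this
  excludes residue fields of characteristic zero, and, since \<open>R\<close> maps to some field of
  characteristic zero, it also excludes that a prime \<open>p\<close> is a unit of \<open>R\<close>. So every prime lies in
  a maximal ideal.
\<close>

section \<open>Subrings \<open>T\<close> of a field with \<open>T[1/q]\<close> a field\<close>

text \<open>The class of subrings fed to Zorn's lemma is the delicate choice. A subring of
  \<open>E\<close> maximal among those without \<open>1/p\<close> is a valuation ring too, but
  inverting \<open>p\<close> need not give all of \<open>E\<close>: in \<open>Q(x)\<close> the ring
  \<open>Z_(p) + x Q[x]_(x)\<close> is maximal without \<open>1/p\<close>, yet adjoining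
  \<open>1/p\<close> yields only \<open>Q[x]_(x)\<close>. Requiring \<open>T[1/p]\<close> to be a
  field rules this out. That field is not fixed beforehand and may grow with \<open>T\<close>; the
  requirement is phrased as divisibility, every nonzero element of \<open>T\<close> divides a power
  of \<open>p\<close> in \<open>T\<close>, so that it passes to unions of chains. The price is that
  a ring above a maximal \<open>T\<close> contradicts maximality only if the divisibility is
  established for it as well. Inside \<open>F\<close> this is automatic, and Chevalley's argument
  runs undisturbed. For elements outside \<open>F\<close> it is the main work. Zorn's lemma starts
  from the integers localized at \<open>p\<close>, a subring of \<open>E\<close> because the
  characteristic is zero.\<close>

lemma (in field) nonzero_inv:
  assumes "x \<in> carrier R" "x \<noteq> \<zero>"
  shows "inv x \<in> carrier R" "x \<otimes> inv x = \<one>" "inv x \<otimes> x = \<one>" "inv x \<noteq> \<zero>"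
proof -
  have "x \<in> Units R" using assms field_Units by blast
  then show "inv x \<in> carrier R" "x \<otimes> inv x = \<one>" and l: "inv x \<otimes> x = \<one>" by auto
  show "inv x \<noteq> \<zero>" using l assms by auto
qed

lemma (in ring) subring_nat_pow:
  assumes "subring K R" "x \<in> K"
  shows "x [^] (n::nat) \<in> K"
  by (induction n) (use assms subringE in \<open>auto simp: subringE(3,6)\<close>)

lemma (in ring) subring_minus:
  assumes "subring K R" "x \<in> K" "y \<in> K"
  shows "x \<ominus> y \<in> K"
  unfolding a_minus_def using assms by (simp add: subringE(5,7))

text \<open>Assumption \<open>cofactor\<close> says that \<open>T[1/q]\<close>, called \<open>F\<close> below, is a field.\<close>

locale adic_subring = field +
  fixes q T
  assumes subring: "subring T R"
    and q_mem: "q \<in> T"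
    and q_nonzero: "q \<noteq> \<zero>"
    and inv_q: "inv q \<notin> T"
    and cofactor: "\<lbrakk>a \<in> T; a \<noteq> \<zero>\<rbrakk> \<Longrightarrow> \<exists>b\<in>T. \<exists>n::nat. a \<otimes> b = q [^] n"
begin

lemmas T_simps = subringE(2,3,5-7)[OF subring] subring_nat_pow[OF subring] subring_minus[OF subring]

lemma T_carrier [simp]: "x \<in> T \<Longrightarrow> x \<in> carrier R"
  using subringE(1)[OF subring] by blast

lemma T_subset: "T \<subseteq> carrier R"
  using subringE(1)[OF subring] .

declare T_simps [simp] q_mem [simp]

lemma q_carrier [simp]: "q \<in> carrier R" using q_mem T_carrier by blast

lemma q_pow_nonzero: "q [^] (n::nat) \<noteq> \<zero>"
  by (induction n) (auto simp: integral_iff q_nonzero)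

definition F where "F = {x \<in> carrier R. \<exists>n::nat. q [^] n \<otimes> x \<in> T}"

lemma F_carrier [simp]: "x \<in> F \<Longrightarrow> x \<in> carrier R"
  by (simp add: F_def)

lemma F_D: "x \<in> F \<Longrightarrow> \<exists>n::nat. q [^] n \<otimes> x \<in> T"
  unfolding F_def by blast

lemma T_sub_F: "T \<subseteq> F"
  unfolding F_def by (auto intro!: exI[of _ 0])

lemma q_pow_mono:
  assumes "q [^] (n::nat) \<otimes> x \<in> T" "x \<in> carrier R" "n \<le> k"
  shows "q [^] k \<otimes> x \<in> T"
proof -
  have "q [^] k \<otimes> x = q [^] (k - n) \<otimes> (q [^] n \<otimes> x)"
    using assms by (simp add: m_assoc[symmetric] nat_pow_mult)
  then show ?thesis using assms by simp
qed

lemma F_subring: "subring F R"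
proof (rule subringI)
  show "F \<subseteq> carrier R" by auto
  show "\<one> \<in> F" using T_sub_F by auto
  show "\<ominus> x \<in> F" if "x \<in> F" for x
    proof -
    from that obtain n :: nat where "q [^] n \<otimes> x \<in> T" "x \<in> carrier R" unfolding F_def by auto
    then have "q [^] n \<otimes> \<ominus> x \<in> T" using T_simps(3) by (simp add: r_minus)
    then show ?thesis using \<open>x \<in> carrier R\<close> unfolding F_def by blast
  qed
next
  fix x y assume "x \<in> F" "y \<in> F"
  then obtain n m :: nat where xy: "q [^] n \<otimes> x \<in> T" "q [^] m \<otimes> y \<in> T"
    and c: "x \<in> carrier R" "y \<in> carrier R" unfolding F_def by auto
  have p: "q [^] n \<in> carrier R" "q [^] m \<in> carrier R" by auto
  have "q [^] (n + m) \<otimes> (x \<otimes> y) = (q [^] n \<otimes> x) \<otimes> (q [^] m \<otimes> y)"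
    unfolding nat_pow_mult[OF q_carrier, symmetric] using p c by algebra
  then show "x \<otimes> y \<in> F" using xy c unfolding F_def by (auto intro!: exI[of _ "n + m"])
  have "q [^] (n + m) \<otimes> (x \<oplus> y) = q [^] m \<otimes> (q [^] n \<otimes> x) \<oplus> q [^] n \<otimes> (q [^] m \<otimes> y)"
    unfolding nat_pow_mult[OF q_carrier, symmetric] using p c by algebra
  then show "x \<oplus> y \<in> F" using xy c unfolding F_def by (auto intro!: exI[of _ "n + m"])
qed

text \<open>From \<open>q [^] n x b = q [^] m\<close> with \<open>b\<close> in \<open>T\<close>, the
  element \<open>q [^] m / x\<close> equals \<open>q [^] n b\<close> and lies in \<open>T\<close>.
  This is what \<open>cofactor\<close> is designed for.\<close>

lemma F_subfield: "subfield F R"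
proof (rule subfieldI'[OF F_subring])
  fix x assume x: "x \<in> F - {\<zero>}"
  then obtain n :: nat where n: "q [^] n \<otimes> x \<in> T" and c: "x \<in> carrier R" "x \<noteq> \<zero>"
    unfolding F_def by auto
  have nz: "q [^] n \<otimes> x \<noteq> \<zero>" using q_pow_nonzero c by (simp add: integral_iff)
  obtain b and m :: nat where b: "b \<in> T" "q [^] n \<otimes> x \<otimes> b = q [^] m"
    using cofactor[OF n nz] by auto
  note i = nonzero_inv[OF c]
  have p: "q [^] n \<in> carrier R" "b \<in> carrier R" using b by auto
  have "q [^] m \<otimes> inv x = (q [^] n \<otimes> b) \<otimes> (x \<otimes> inv x)"
    unfolding b(2)[symmetric] using p c(1) i(1) by algebra
  also have "\<dots> = q [^] n \<otimes> b" using i p by simp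
  finally have "q [^] m \<otimes> inv x \<in> T" using b by simp
  then show "inv x \<in> F" unfolding F_def using i by auto
qed

lemma F_inv: "x \<in> F \<Longrightarrow> x \<noteq> \<zero> \<Longrightarrow> inv x \<in> F"
  using subfield_m_inv(1)[OF F_subfield, of x] by auto

lemmas F_simps = subringE(2,3,5-7)[OF F_subring] subring_nat_pow[OF F_subring] subring_minus[OF F_subring]
declare F_simps [simp]

lemma T_F [simp]: "x \<in> T \<Longrightarrow> x \<in> F" using T_sub_F by blast

lemma F_saturated:
  assumes "x \<in> carrier R" "q [^] (n::nat) \<otimes> x \<in> F"
  shows "x \<in> F"
  using subfield_m_inv_simprule[OF F_subfield, of "q [^] n" x] assms q_pow_nonzero by auto

text \<open>Between \<open>T\<close> and \<open>F\<close> the divisibility condition is inherited: a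
  multiple \<open>q [^] n a\<close> lies in \<open>T\<close>, and \<open>q [^] n\<close> times its
  cofactor there is a cofactor of \<open>a\<close>. Only the absence of \<open>1/q\<close> remains
  to be checked.\<close>

lemma adic_subring_enlarge:
  assumes "subring S R" "T \<subseteq> S" "S \<subseteq> F" "inv q \<notin> S"
  shows "adic_subring R q S"
proof (intro adic_subring.intro[OF field_axioms] adic_subring_axioms.intro)
  fix a assume a: "a \<in> S" "a \<noteq> \<zero>"
  then obtain n :: nat where n: "q [^] n \<otimes> a \<in> T" "a \<in> carrier R" using assms unfolding F_def by auto
  then have nz: "q [^] n \<otimes> a \<noteq> \<zero>" using q_pow_nonzero a n by (simp add: integral_iff)
  obtain b and m :: nat where b: "b \<in> T" "q [^] n \<otimes> a \<otimes> b = q [^] m"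
    using cofactor[OF n(1) nz] by auto
  have "a \<otimes> (q [^] n \<otimes> b) = q [^] m"
    unfolding b(2)[symmetric] using b(1) n(2) by (simp add: m_ac)
  moreover have "q [^] n \<otimes> b \<in> S" using assms b by auto
  ultimately show "\<exists>b\<in>S. \<exists>n::nat. a \<otimes> b = q [^] n" by blast
qed (use assms q_nonzero in auto)

end

text \<open>The values at \<open>c\<close> of polynomials over \<open>K\<close> of degree at most
  \<open>n\<close>. The top coefficient may vanish, so \<open>n\<close> is only a bound and the sets
  increase with \<open>n\<close>. Working with values suffices, since the arguments below only
  compare degrees of relations.\<close>

fun (in ring) poly_values :: "'a set \<Rightarrow> 'a \<Rightarrow> nat \<Rightarrow> 'a set" where
  "poly_values K c 0 = K"
| "poly_values K c (Suc n) = {g \<oplus> t \<otimes> c [^] Suc n | g t. g \<in> poly_values K c n \<and> t \<in> K}"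

section \<open>Calculus with values of polynomials of bounded degree\<close>

context cring
begin

context
  fixes K c
  assumes K: "subring K R" and c [simp]: "c \<in> carrier R"
begin

lemma K_carrier: "t \<in> K \<Longrightarrow> t \<in> carrier R"
  using subringE(1)[OF K] by blast

lemma poly_values_carrier: "g \<in> poly_values K c n \<Longrightarrow> g \<in> carrier R"
  by (induction n arbitrary: g) (auto simp: K_carrier)

lemma poly_values_Suc: "g \<in> poly_values K c n \<Longrightarrow> g \<in> poly_values K c (Suc n)"
proof -
  assume g: "g \<in> poly_values K c n"
  then have "g = g \<oplus> \<zero> \<otimes> c [^] Suc n" using poly_values_carrier by simp
  then show "g \<in> poly_values K c (Suc n)"
    unfolding poly_values.simps using g subringE(2)[OF K] by blast
qed

lemma poly_values_mono: "n \<le> m \<Longrightarrow> g \<in> poly_values K c n \<Longrightarrow> g \<in> poly_values K c m"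
  by (induction m rule: dec_induct) (use poly_values_Suc in blast)+

lemma poly_values_add:
  "g \<in> poly_values K c n \<Longrightarrow> h \<in> poly_values K c n \<Longrightarrow> g \<oplus> h \<in> poly_values K c n"
proof (induction n arbitrary: g h)
  case 0
  then show ?case using subringE(7)[OF K] by simp
next
  case (Suc n)
  obtain g' t where g: "g = g' \<oplus> t \<otimes> c [^] Suc n" "g' \<in> poly_values K c n" "t \<in> K"
    using Suc.prems by auto
  obtain h' u where h: "h = h' \<oplus> u \<otimes> c [^] Suc n" "h' \<in> poly_values K c n" "u \<in> K"
    using Suc.prems by auto
  have car: "g' \<in> carrier R" "h' \<in> carrier R" "t \<in> carrier R" "u \<in> carrier R"
    "c [^] Suc n \<in> carrier R"
    using g h poly_values_carrier K_carrier by auto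
  have "g \<oplus> h = (g' \<oplus> h') \<oplus> (t \<oplus> u) \<otimes> c [^] Suc n"
    unfolding g h using car by algebra
  then show ?case using Suc.IH[OF g(2) h(2)] subringE(7)[OF K g(3) h(3)] by auto
qed

lemma poly_values_scale:
  "g \<in> poly_values K c n \<Longrightarrow> s \<in> K \<Longrightarrow> s \<otimes> g \<in> poly_values K c n"
proof (induction n arbitrary: g)
  case 0
  then show ?case using subringE(6)[OF K] by simp
next
  case (Suc n)
  obtain g' t where g: "g = g' \<oplus> t \<otimes> c [^] Suc n" "g' \<in> poly_values K c n" "t \<in> K"
    using Suc.prems by auto
  have car: "g' \<in> carrier R" "s \<in> carrier R" "t \<in> carrier R" "c [^] Suc n \<in> carrier R"
    using g Suc.prems poly_values_carrier K_carrier by auto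
  have "s \<otimes> g = (s \<otimes> g') \<oplus> (s \<otimes> t) \<otimes> c [^] Suc n"
    unfolding g using car by algebra
  then show ?case using Suc.IH[OF g(2)] Suc.prems subringE(6)[OF K Suc.prems(2) g(3)] by auto
qed

lemma poly_values_a_inv: "g \<in> poly_values K c n \<Longrightarrow> \<ominus> g \<in> poly_values K c n"
  using poly_values_scale[of g n "\<ominus> \<one>"] poly_values_carrier[of g n] subringE(3,5)[OF K]
  by (auto simp: l_minus)

lemma poly_values_const: "t \<in> K \<Longrightarrow> t \<in> poly_values K c n"
  using poly_values_mono[of 0 n t] by simp

lemma poly_values_zero: "\<zero> \<in> poly_values K c n"
  using poly_values_const subringE(2)[OF K] by blast

lemma poly_values_monom:
  assumes "k \<le> n" "t \<in> K"
  shows "t \<otimes> c [^] k \<in> poly_values K c n"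
proof (rule poly_values_mono[OF assms(1)], cases k)
  case 0
  then show "t \<otimes> c [^] k \<in> poly_values K c k" using assms K_carrier by simp
next
  case (Suc j)
  have "t \<otimes> c [^] k = \<zero> \<oplus> t \<otimes> c [^] Suc j" using Suc K_carrier assms by simp
  then show "t \<otimes> c [^] k \<in> poly_values K c k" using Suc assms poly_values_zero by auto
qed

lemma poly_values_shift: "g \<in> poly_values K c n \<Longrightarrow> g \<otimes> c \<in> poly_values K c (Suc n)"
proof (induction n arbitrary: g)
  case 0
  then show ?case using poly_values_monom[of 1 1 g] by simp
next
  case (Suc n)
  obtain g' t where g: "g = g' \<oplus> t \<otimes> c [^] Suc n" "g' \<in> poly_values K c n" "t \<in> K"
    using Suc.prems by auto
  have car: "g' \<in> carrier R" "t \<in> carrier R" "c [^] n \<in> carrier R"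
    using g poly_values_carrier K_carrier by auto
  have "g \<otimes> c = (g' \<otimes> c) \<oplus> t \<otimes> c [^] Suc (Suc n)"
    unfolding g nat_pow_Suc using car c by algebra
  then show ?case using Suc.IH[OF g(2)] g(3) by auto
qed

text \<open>The recursion exposes the leading term; the descent in Chevalley's argument needs the
  constant term instead.\<close>

lemma poly_values_split_const:
  "g \<in> poly_values K c (Suc n) \<Longrightarrow> \<exists>u\<in>K. \<exists>h\<in>poly_values K c n. g = u \<oplus> h \<otimes> c"
proof (induction n arbitrary: g)
  case 0
  then show ?case by (auto)
next
  case (Suc n)
  obtain g' t where g: "g = g' \<oplus> t \<otimes> c [^] Suc (Suc n)" "g' \<in> poly_values K c (Suc n)" "t \<in> K"
    using Suc.prems by (subst (asm) poly_values.simps) blast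
  obtain u h where u: "u \<in> K" "h \<in> poly_values K c n" "g' = u \<oplus> h \<otimes> c"
    using Suc.IH[OF g(2)] by blast
  have car: "h \<in> carrier R" "t \<in> carrier R" "u \<in> carrier R" "c [^] n \<in> carrier R"
    using g u poly_values_carrier K_carrier by auto
  have "g = u \<oplus> (h \<oplus> t \<otimes> c [^] Suc n) \<otimes> c"
    unfolding g u nat_pow_Suc using car c by algebra
  moreover have "h \<oplus> t \<otimes> c [^] Suc n \<in> poly_values K c (Suc n)" using u g by auto
  ultimately show ?case using u by blast
qed

lemma simple_extension_poly_values:
  "s \<in> simple_extension K c \<Longrightarrow> \<exists>n. s \<in> poly_values K c n"
proof (induction rule: simple_extension.induct)
  case zero
  then show ?case using poly_values_zero by blast
next
  case (lin g t)
  then obtain n where "g \<in> poly_values K c n" by blast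
  then have "g \<otimes> c \<oplus> t \<in> poly_values K c (Suc n)"
    using poly_values_add poly_values_shift poly_values_const lin by blast
  then show ?case by blast
qed

text \<open>An integral equation of degree \<open>Suc n\<close> keeps the degree bounded: whenever
  multiplication by \<open>c\<close> produces a term in \<open>c [^] Suc n\<close>, the equation
  rewrites it in lower powers.\<close>

lemma simple_extension_integral:
  assumes "c [^] Suc n \<in> poly_values K c n"
  shows "simple_extension K c \<subseteq> poly_values K c n"
proof
  fix s assume "s \<in> simple_extension K c"
  then show "s \<in> poly_values K c n"
  proof (induction rule: simple_extension.induct)
    case zero
    then show ?case using poly_values_zero by blast
  next
    case (lin g t)
    obtain g' u where gu: "g \<otimes> c = g' \<oplus> u \<otimes> c [^] Suc n" "g' \<in> poly_values K c n" "u \<in> K"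
      using poly_values_shift[OF lin(3)] by auto
    show ?case
      unfolding gu(1)
      by (intro poly_values_add poly_values_scale poly_values_const assms gu(2,3) lin(2))
  qed
qed

text \<open>With \<open>d = 1/c\<close>, multiplication by \<open>c [^] k\<close> turns each
  \<open>t d [^] i\<close> into \<open>t c [^] (k - i)\<close>, reversing the coefficients.\<close>

lemma poly_values_reverse:
  assumes "d \<in> carrier R" "c \<otimes> d = \<one>"
  shows "j \<le> k \<Longrightarrow> g \<in> poly_values K d j \<Longrightarrow> c [^] k \<otimes> g \<in> poly_values K c k"
proof (induction j arbitrary: g)
  case 0
  then show ?case using poly_values_monom[of k k g] K_carrier by (simp add: m_comm)
next
  case (Suc j)
  obtain h t where g: "g = h \<oplus> t \<otimes> d [^] Suc j" "h \<in> poly_values K d j" "t \<in> K"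
    using Suc.prems by auto
  have "c [^] k = c [^] (k - Suc j) \<otimes> c [^] Suc j" using Suc.prems by (simp only: nat_pow_mult c) simp
  moreover have "c [^] Suc j \<otimes> d [^] Suc j = \<one>"
    using nat_pow_distrib[OF c assms(1), of "Suc j"] assms(2) by simp
  ultimately have pow: "c [^] k \<otimes> d [^] Suc j = c [^] (k - Suc j)"
    using assms m_assoc by simp
  have car: "h \<in> carrier R" "t \<in> carrier R" "c [^] k \<in> carrier R" "d [^] Suc j \<in> carrier R"
    using g assms K_carrier ring.poly_values.simps by (auto simp: cring.poly_values_carrier[OF cring_axioms K assms(1)])
  have "c [^] k \<otimes> g = c [^] k \<otimes> h \<oplus> t \<otimes> (c [^] k \<otimes> d [^] Suc j)"
    unfolding g using car by algebra
  then show ?case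
    using Suc poly_values_monom[of "k - Suc j" k t] g poly_values_add unfolding pow by simp
qed

end

end

section \<open>A maximal \<open>T\<close> is a valuation ring of \<open>F\<close>\<close>

locale maximal_adic_subring = adic_subring +
  assumes maximal: "\<lbrakk>adic_subring R q S; T \<subseteq> S\<rbrakk> \<Longrightarrow> S = T"
begin

lemma saturated:
  assumes "subring S R" "T \<subseteq> S" "S \<subseteq> F" "inv q \<notin> S"
  shows "S = T"
  using maximal adic_subring_enlarge assms by blast

text \<open>The ring \<open>T[c]\<close> lies strictly above \<open>T\<close> and inside
  \<open>F\<close>, so by maximality the only condition it can violate is the absence of
  \<open>1/q\<close>.\<close>

lemma inv_q_mem_simple_extension:
  assumes "c \<in> F" "c \<notin> T"
  shows "inv q \<in> simple_extension T c"
proof (rule ccontr)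
  assume *: "inv q \<notin> simple_extension T c"
  have c: "c \<in> carrier R" using assms by simp
  have "T \<subseteq> simple_extension T c"
    using simple_extension_incl[OF T_subset c] .
  then have "simple_extension T c = T"
    using saturated[of "simple_extension T c"] simple_extension_is_subring[OF subring c]
      simple_extension_subring_incl[OF F_subring T_sub_F assms(1)] * by blast
  then show False using simple_extension_mem[OF subring c] assms by simp
qed

lemma inv_q_unique: "t \<in> carrier R \<Longrightarrow> q \<otimes> t = \<one> \<Longrightarrow> inv q = t"
  using comm_inv_char by simp

text \<open>This places \<open>q\<close> in the Jacobson radical of \<open>T\<close> before
  \<open>T\<close> is known to be local. For \<open>u = 1 - q t\<close>, every power of
  \<open>u\<close> has the form \<open>1 - q r\<close>. If \<open>1/u\<close> were outside
  \<open>T\<close>, then \<open>1/q\<close> would lie in \<open>T[1/u]\<close>, so some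
  \<open>u [^] n / q = 1/q - r\<close> would lie in \<open>T\<close>, and hence \<open>1/q\<close>
  too.\<close>

lemma one_minus_q_unit:
  assumes t: "t \<in> T"
  shows "\<one> \<ominus> q \<otimes> t \<noteq> \<zero>" "inv (\<one> \<ominus> q \<otimes> t) \<in> T"
proof -
  define u where "u = \<one> \<ominus> q \<otimes> t"
  have uT: "u \<in> T" and tc [simp]: "t \<in> carrier R" using t unfolding u_def by auto
  then have uc: "u \<in> carrier R" by simp
  have u_pow: "\<exists>r\<in>T. u [^] n = \<one> \<ominus> q \<otimes> r" for n :: nat
  proof (induction n)
    case 0
    then show ?case by (auto intro!: bexI[of _ \<zero>] simp: a_minus_def)
  next
    case (Suc n)
    then obtain r where r: "r \<in> T" "u [^] n = \<one> \<ominus> q \<otimes> r" by blast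
    then have "r \<in> carrier R" by simp
    then have "(\<one> \<ominus> q \<otimes> r) \<otimes> (\<one> \<ominus> q \<otimes> t) = \<one> \<ominus> q \<otimes> (r \<oplus> t \<ominus> q \<otimes> r \<otimes> t)"
      using tc q_carrier by algebra
    then have "u [^] Suc n = \<one> \<ominus> q \<otimes> (r \<oplus> t \<ominus> q \<otimes> r \<otimes> t)"
      unfolding nat_pow_Suc r(2) by (simp only: u_def)
    then show ?case using r t by (auto intro!: bexI[of _ "r \<oplus> t \<ominus> q \<otimes> r \<otimes> t"])
  qed
  have "u \<noteq> \<zero>"
  proof
    assume "u = \<zero>"
    then have "q \<otimes> t = \<one>" unfolding u_def using r_right_minus_eq[of \<one> "q \<otimes> t"] by simp
    then show False using inv_q_unique[OF tc] inv_q t by simp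
  qed
  then show "\<one> \<ominus> q \<otimes> t \<noteq> \<zero>" by (simp add: u_def)
  note iu = nonzero_inv[OF uc \<open>u \<noteq> \<zero>\<close>]
  have "\<exists>n::nat. s \<otimes> u [^] n \<in> T" if "s \<in> simple_extension T (inv u)" for s
    using that
  proof (induction rule: simple_extension.induct)
    case zero
    then show ?case using uc by auto
  next
    case (lin g v)
    then obtain n :: nat where n: "g \<otimes> u [^] n \<in> T" by blast
    have g: "g \<in> carrier R" using simple_extension_in_carrier[OF T_subset iu(1)] lin by blast
    have v: "v \<in> carrier R" "u [^] n \<in> carrier R" using lin uc by auto
    have "(g \<otimes> inv u \<oplus> v) \<otimes> u [^] Suc n = (g \<otimes> u [^] n) \<otimes> (inv u \<otimes> u) \<oplus> v \<otimes> (u [^] n \<otimes> u)"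
      unfolding nat_pow_Suc using g v uc iu(1) by algebra
    also have "\<dots> \<in> T" using iu n lin uT by auto
    finally show ?case by blast
  qed
  moreover have "inv q \<otimes> u [^] n \<notin> T" for n :: nat
  proof
    assume a: "inv q \<otimes> u [^] n \<in> T"
    obtain r where r: "r \<in> T" "u [^] n = \<one> \<ominus> q \<otimes> r" using u_pow by blast
    note iq = nonzero_inv[OF q_carrier q_nonzero]
    have rc: "r \<in> carrier R" using r by simp
    have "inv q \<otimes> u [^] n = inv q \<ominus> (inv q \<otimes> q) \<otimes> r"
      unfolding r(2) using rc iq(1) q_carrier by algebra
    then have "inv q = inv q \<otimes> u [^] n \<oplus> r"
      using rc iq by (simp add: a_minus_def a_assoc l_neg)
    moreover have "inv q \<otimes> u [^] n \<oplus> r \<in> T" using a r by (intro T_simps(5))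
    ultimately show False using inv_q by simp
  qed
  ultimately have "inv u \<in> T"
    using inv_q_mem_simple_extension[of "inv u"] F_inv[of u] uT \<open>u \<noteq> \<zero>\<close> by auto
  then show "inv (\<one> \<ominus> q \<otimes> t) \<in> T" by (simp add: u_def)
qed

text \<open>Chevalley's argument: a relation \<open>1/q = f(1/c)\<close> of degree at most that of a relation
  \<open>1/q = g(c)\<close> makes \<open>c\<close> integral over \<open>T\<close> and thus lowers the degree of \<open>g\<close>.\<close>

lemma degree_descent:
  assumes c: "c \<in> carrier R" and d: "d \<in> carrier R" and cd: "c \<otimes> d = \<one>"
    and n: "inv q \<in> poly_values T c n" "\<And>k. k < n \<Longrightarrow> inv q \<notin> poly_values T c k"
    and m: "inv q \<in> poly_values T d m" "m \<le> n"
  shows False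
proof -
  have "m \<noteq> 0" using m inv_q by (cases m) auto
  then obtain m' n' where mn: "m = Suc m'" "n = Suc n'" using m(2) by (cases m; cases n) auto
  obtain u h where u: "u \<in> T" "h \<in> poly_values T d m'" "inv q = u \<oplus> h \<otimes> d"
    using poly_values_split_const[OF subring d] m mn by blast
  \<comment> \<open>Multiplying \<open>1/q = u + h d\<close> by \<open>q\<close> and then by
    \<open>c\<close> gives \<open>w c = q h\<close>. As \<open>w\<close> is invertible in
    \<open>T\<close>, this expresses \<open>c\<close> as a polynomial in \<open>d\<close> of degree
    at most \<open>m'\<close>.\<close>
  define w where "w = \<one> \<ominus> q \<otimes> u"
  note w = one_minus_q_unit[OF u(1), folded w_def]
  have wc: "w \<in> carrier R" using u unfolding w_def by simp
  note iw = nonzero_inv[OF wc w(1)]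
  note iq = nonzero_inv[OF q_carrier q_nonzero]
  have hc: "h \<in> carrier R" "u \<in> carrier R" using u poly_values_carrier[OF subring d] by auto
  have "q \<otimes> u \<oplus> q \<otimes> h \<otimes> d = \<one>" using u(3) iq hc d by (simp add: r_distr[symmetric] m_assoc)
  moreover have "(q \<otimes> u \<oplus> q \<otimes> h \<otimes> d) \<ominus> q \<otimes> u = q \<otimes> h \<otimes> d"
    using hc d q_carrier by algebra
  ultimately have "w = q \<otimes> h \<otimes> d" by (simp only: w_def)
  then have "w \<otimes> c = q \<otimes> h \<otimes> (c \<otimes> d)" using hc d c by (simp add: m_ac)
  then have "inv w \<otimes> (w \<otimes> c) = (q \<otimes> inv w) \<otimes> h" using cd hc iw(1) by (simp add: m_ac)
  then have c_eq: "c = (q \<otimes> inv w) \<otimes> h" using iw c wc by (simp add: m_assoc[symmetric])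
  have "(q \<otimes> inv w) \<otimes> h \<in> poly_values T d m'"
    using poly_values_scale[OF subring d u(2)] w by simp
  \<comment> \<open>Since \<open>m' \<le> n'\<close>, multiplying the expression for
    \<open>c\<close> by \<open>c [^] n'\<close> leaves no negative powers of \<open>c\<close>: an
    integral equation of degree \<open>Suc n'\<close>.\<close>
  then have "c [^] n' \<otimes> c \<in> poly_values T c n'"
    using poly_values_reverse[OF subring c d cd, of m' n'] c_eq m(2) mn by simp
  then have "c [^] Suc n' \<in> poly_values T c n'" by simp
  moreover obtain g t where gt: "inv q = g \<oplus> t \<otimes> c [^] Suc n'" "g \<in> poly_values T c n'" "t \<in> T"
    using n mn by auto
  ultimately have "inv q \<in> poly_values T c n'"
    unfolding gt(1) by (intro poly_values_add[OF subring c] poly_values_scale[OF subring c])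
  then show False using n mn by simp
qed

text \<open>If both memberships failed, \<open>1/q\<close> would be a polynomial over
  \<open>T\<close> in \<open>c\<close> and also in \<open>1/c\<close>. With both degrees minimal,
  \<open>degree_descent\<close> lowers the larger one; its hypotheses are symmetric in
  \<open>c\<close> and \<open>1/c\<close>.\<close>

lemma valuation_dichotomy:
  assumes c: "c \<in> F" "c \<noteq> \<zero>"
  shows "c \<in> T \<or> inv c \<in> T"
proof (rule ccontr)
  assume neg: "\<not> (c \<in> T \<or> inv c \<in> T)"
  have cc: "c \<in> carrier R" using c by simp
  note ic = nonzero_inv[OF cc c(2)]
  let ?P = "\<lambda>d n. inv q \<in> poly_values T d n"
  have ex: "\<exists>n. ?P c n" "\<exists>n. ?P (inv c) n"
    using neg simple_extension_poly_values[OF subring cc inv_q_mem_simple_extension[OF c(1)]]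
      simple_extension_poly_values[OF subring ic(1) inv_q_mem_simple_extension[OF F_inv[OF c]]]
    by simp_all
  define n m where "n = (LEAST n. ?P c n)" and "m = (LEAST n. ?P (inv c) n)"
  have nm: "?P c n" "?P (inv c) m" unfolding n_def m_def by (rule LeastI_ex[OF ex(1)], rule LeastI_ex[OF ex(2)])
  have min: "\<And>k. k < n \<Longrightarrow> \<not> ?P c k" "\<And>k. k < m \<Longrightarrow> \<not> ?P (inv c) k"
    unfolding n_def m_def by (fact not_less_Least)+
  show False
  proof (cases "m \<le> n")
    case True
    then show False using degree_descent[OF cc ic(1,2) nm(1) min(1) nm(2)] by blast
  next
    case False
    then show False using degree_descent[OF ic(1) cc ic(3) nm(2) min(2) nm(1)] by simp
  qed
qed

end

section \<open>Algebraic elements lie in \<open>F\<close>\<close>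

lemma (in cring) eval_poly_values:
  assumes K: "subring K R" and c: "c \<in> carrier R"
  shows "set ts \<subseteq> K \<Longrightarrow> length ts \<le> Suc n \<Longrightarrow> eval ts c \<in> poly_values K c n"
proof (induction ts)
  case Nil
  then show ?case using poly_values_zero[OF K c] by simp
next
  case (Cons a ts)
  then have "a \<otimes> c [^] length ts \<in> poly_values K c n" "eval ts c \<in> poly_values K c n"
    using poly_values_monom[OF K c, of "length ts" n a] by auto
  then show ?case using poly_values_add[OF K c] by simp
qed

lemma (in ring) poly_values_subset:
  "K \<subseteq> L \<Longrightarrow> poly_values K c n \<subseteq> poly_values L c n"
  by (induction n) auto

context maximal_adic_subring
begin

text \<open>The leading coefficient of an annihilating polynomial is invertible in \<open>F\<close>,
  so the polynomial can be made monic. Its degree is positive because a nonzero constant annihilates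
  nothing; hence the form \<open>Suc d\<close>.\<close>

lemma algebraic_poly_values:
  assumes x: "x \<in> carrier R" "(algebraic over F) x"
  shows "\<exists>d. x [^] Suc d \<in> poly_values F x d"
proof -
  obtain p where p: "p \<in> carrier (F[X])" "p \<noteq> []" "eval p x = \<zero>"
    using algebraicE[OF F_subring x] by blast
  then obtain l ts where lts: "p = l # ts" by (cases p) auto
  have pol: "polynomial F p" using p(1) by (simp add: univ_poly_carrier)
  then have l: "l \<in> F" "l \<noteq> \<zero>" and ts: "set ts \<subseteq> F"
    using lts unfolding polynomial_def by auto
  have lc: "l \<in> carrier R" using l by simp
  have tc: "eval ts x \<in> carrier R"
    using eval_in_carrier[OF _ x(1)] ts subringE(1)[OF F_subring] by blast
  have pc: "x [^] length ts \<in> carrier R" using x by simp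
  have eq: "l \<otimes> x [^] length ts \<oplus> eval ts x = \<zero>" using p(3) lts by simp
  note il = nonzero_inv[OF lc l(2)]
  have "l \<otimes> x [^] length ts = \<ominus> eval ts x"
    using minus_equality[OF eq] tc lc pc by simp
  then have "inv l \<otimes> (l \<otimes> x [^] length ts) = inv l \<otimes> (\<ominus> eval ts x)" by simp
  then have x_pow: "x [^] length ts = (\<ominus> (inv l)) \<otimes> eval ts x"
    using il lc pc tc by (simp add: m_assoc[symmetric] l_minus r_minus)
  show ?thesis
  proof (cases ts)
    case Nil
    then show ?thesis using eq l lc by simp
  next
    case (Cons t us)
    have "eval ts x \<in> poly_values F x (length us)"
      using eval_poly_values[OF F_subring x(1) ts] Cons by simp
    then have "x [^] Suc (length us) \<in> poly_values F x (length us)"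
      using poly_values_scale[OF F_subring x(1)] F_inv[OF l] x_pow Cons by simp
    then show ?thesis by blast
  qed
qed

text \<open>Put \<open>b = q [^] k\<close>. Multiplying by \<open>b [^] Suc n\<close> turns a term
  \<open>t y [^] i\<close> with \<open>i \<le> n\<close> into \<open>t b [^] (Suc n - i)\<close>
  times \<open>(b y) [^] i\<close>. At least one factor \<open>b\<close> is left for every
  coefficient, the top one included, and clears its denominator once \<open>k\<close> is large. The
  same exponent turns \<open>y [^] Suc n\<close> into \<open>(b y) [^] Suc n\<close>. Asking for all
  large \<open>k\<close> lets the induction step pick a common one.\<close>

lemma poly_values_rescale:
  assumes y: "y \<in> carrier R"
  shows "g \<in> poly_values F y n \<Longrightarrow>
    \<exists>m. \<forall>k\<ge>m. (q [^] k) [^] Suc n \<otimes> g \<in> poly_values T (q [^] (k::nat) \<otimes> y) n"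
proof (induction n arbitrary: g)
  case 0
  then have gF: "g \<in> F" by simp
  obtain m :: nat where m: "q [^] m \<otimes> g \<in> T" using F_D[OF gF] by blast
  have "(q [^] k) [^] Suc 0 \<otimes> g \<in> T" if "k \<ge> m" for k :: nat
    using q_pow_mono[OF m F_carrier[OF gF] that] by simp
  then show ?case by auto
next
  case (Suc n)
  then obtain h t where g: "g = h \<oplus> t \<otimes> y [^] Suc n" "h \<in> poly_values F y n" "t \<in> F" by auto
  obtain m where m: "\<And>k. k \<ge> m \<Longrightarrow>
      (q [^] k) [^] Suc n \<otimes> h \<in> poly_values T (q [^] (k::nat) \<otimes> y) n"
    using Suc.IH[OF g(2)] by blast
  obtain m' :: nat where m': "q [^] m' \<otimes> t \<in> T" and tc: "t \<in> carrier R"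
    using F_D[OF g(3)] F_carrier[OF g(3)] by blast
  have hc: "h \<in> carrier R" using poly_values_carrier[OF F_subring y g(2)] .
  have "(q [^] k) [^] Suc (Suc n) \<otimes> g \<in> poly_values T (q [^] k \<otimes> y) (Suc n)"
    if k: "k \<ge> max m m'" for k :: nat
  proof -
    define b Y where "b = q [^] k" and "Y = y [^] Suc n"
    have b: "b \<in> T" "b \<in> carrier R" unfolding b_def by simp_all
    have Yc: "Y \<in> carrier R" "b [^] Suc n \<in> carrier R" using y b unfolding Y_def by simp_all
    have z: "(b \<otimes> y) [^] Suc n = b [^] Suc n \<otimes> Y"
      unfolding Y_def by (rule nat_pow_distrib[OF b(2) y])
    have "b [^] Suc (Suc n) \<otimes> g = b \<otimes> (b [^] Suc n \<otimes> h) \<oplus> (b \<otimes> t) \<otimes> (b [^] Suc n \<otimes> Y)"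
      unfolding g nat_pow_Suc[of b "Suc n"] Y_def[symmetric] using b Yc hc tc by algebra
    moreover have "b \<otimes> (b [^] Suc n \<otimes> h) \<in> poly_values T (b \<otimes> y) n"
      using poly_values_scale[OF subring] m[of k] k b y unfolding b_def by simp
    moreover have "b \<otimes> t \<in> T" using q_pow_mono[OF m' tc] k unfolding b_def by simp
    ultimately show ?thesis unfolding b_def[symmetric] poly_values.simps z by blast
  qed
  then show ?case by blast
qed

text \<open>Denominators arise from \<open>y = z / q [^] k\<close> and from the coefficients in
  \<open>F\<close>, and all are powers of \<open>q\<close>. The purpose is to turn inverses in the
  field \<open>F[y]\<close> into cofactors in \<open>T[z]\<close>.\<close>

lemma simple_extension_rescale:
  assumes y: "y \<in> carrier R" and z: "z = q [^] (k::nat) \<otimes> y"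
  shows "g \<in> simple_extension F y \<Longrightarrow> \<exists>m::nat. q [^] m \<otimes> g \<in> simple_extension T z"
proof (induction rule: simple_extension.induct)
  case zero
  then show ?case by auto
next
  case (lin g t)
  have zc: "z \<in> carrier R" using y z by simp
  note S = subringE[OF simple_extension_is_subring[OF subring zc]]
  have TS: "T \<subseteq> simple_extension T z" using simple_extension_incl[OF T_subset zc] .
  have zS: "z \<in> simple_extension T z" using simple_extension_mem[OF subring zc] .
  obtain m :: nat where m: "q [^] m \<otimes> g \<in> simple_extension T z" using lin by blast
  obtain j :: nat where j: "q [^] j \<otimes> t \<in> T" using F_D[OF lin(2)] by blast
  have car: "g \<in> carrier R" "t \<in> carrier R" "q [^] m \<in> carrier R" "q [^] j \<in> carrier R"
    "q [^] k \<in> carrier R"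
    using simple_extension_in_carrier[OF subringE(1)[OF F_subring] y] lin(1,2) by auto
  \<comment> \<open>The exponents \<open>m\<close>, \<open>k\<close> and \<open>j\<close> clear the
    denominators of \<open>g\<close>, \<open>y\<close> and \<open>t\<close> respectively.\<close>
  have "q [^] (j + (m + k)) \<otimes> (g \<otimes> y \<oplus> t)
    = q [^] j \<otimes> ((q [^] m \<otimes> g) \<otimes> z) \<oplus> (q [^] m \<otimes> q [^] k) \<otimes> (q [^] j \<otimes> t)"
    unfolding nat_pow_mult[OF q_carrier, symmetric] z using car y by algebra
  also have "\<dots> \<in> simple_extension T z"
    proof (rule S(7))
    have pow: "q [^] n \<in> simple_extension T z" for n :: nat
      using TS by (rule subsetD) simp
    show "q [^] j \<otimes> ((q [^] m \<otimes> g) \<otimes> z) \<in> simple_extension T z"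
      by (rule S(6)[OF pow S(6)[OF m zS]])
    show "(q [^] m \<otimes> q [^] k) \<otimes> (q [^] j \<otimes> t) \<in> simple_extension T z"
      by (rule S(6)[OF S(6)[OF pow pow] subsetD[OF TS j]])
  qed
  finally show ?case by blast
qed

text \<open>Taking the degree \<open>d\<close> minimal among all algebraic elements outside \<open>F\<close> keeps it minimal
  after scaling by powers of \<open>q\<close>.\<close>

lemma algebraic_imp_mem:
  assumes x: "x \<in> carrier R" "(algebraic over F) x"
  shows "x \<in> F"
proof (rule ccontr)
  assume xF: "x \<notin> F"
  \<comment> \<open>Here \<open>d\<close> is one less than the degree of a monic equation over
    \<open>F\<close>.\<close>
  define P where "P d \<longleftrightarrow> (\<exists>y \<in> carrier R - F. (algebraic over F) y \<and> y [^] Suc d \<in> poly_values F y d)" for d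
  define d where "d = (LEAST d. P d)"
  obtain d' where "x [^] Suc d' \<in> poly_values F x d'"
    using algebraic_poly_values[OF x] by blast
  then have "P d'" unfolding P_def by (intro bexI[of _ x] conjI DiffI x xF)
  then have "P d" unfolding d_def by (rule LeastI)
  then obtain y where y: "y \<in> carrier R" "y \<notin> F" "(algebraic over F) y" "y [^] Suc d \<in> poly_values F y d"
    unfolding P_def by blast
  have min: "\<not> z [^] Suc e \<in> poly_values F z e" if "e < d" "z \<in> carrier R - F" "(algebraic over F) z" for e z
  proof
    assume "z [^] Suc e \<in> poly_values F z e"
    then have "P e" unfolding P_def by (intro bexI[of _ z] conjI that(2,3))
    then show False using not_less_Least that(1) unfolding d_def by blast
  qed
  obtain k where k: "(q [^] k) [^] Suc d \<otimes> y [^] Suc d \<in> poly_values T (q [^] (k::nat) \<otimes> y) d"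
    using poly_values_rescale[OF y(1,4)] order_refl by metis
  define z where "z = q [^] k \<otimes> y"
  have zc: "z \<in> carrier R" using y unfolding z_def by simp
  have zF: "z \<notin> F" using F_saturated[OF y(1), of k] y(2) unfolding z_def by auto
  have Fy: "subfield (simple_extension F y) R"
    using simple_extension_is_subfield[OF F_subfield y(1)] y(3) by simp
  have FFy: "F \<subseteq> simple_extension F y"
    using simple_extension_incl[OF subringE(1)[OF F_subring] y(1)] .
  have zFy: "z \<in> simple_extension F y"
    unfolding z_def
    by (rule subringE(6)[OF subfieldE(1)[OF Fy] subsetD[OF FFy] simple_extension_mem[OF F_subring y(1)]]) simp
  have zalg: "(algebraic over F) z"
    using simple_extesion_mem_imp_algebraic[OF F_subfield y(1,3) zFy] .
  define S where "S = simple_extension T z"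
  have S: "subring S R" unfolding S_def using simple_extension_is_subring[OF subring zc] .
  have TS: "T \<subseteq> S" unfolding S_def using simple_extension_incl[OF T_subset zc] .
  have zS: "z \<in> S" unfolding S_def using simple_extension_mem[OF subring zc] .
  have SFy: "S \<subseteq> simple_extension F y"
    unfolding S_def using simple_extension_subring_incl[OF subfieldE(1)[OF Fy] subset_trans[OF T_sub_F FFy] zFy] .
  have "z [^] Suc d \<in> poly_values T z d"
    using k nat_pow_distrib[of "q [^] k" y "Suc d"] y(1) unfolding z_def by simp
  then have S_le: "S \<subseteq> poly_values T z d"
    unfolding S_def using simple_extension_integral[OF subring zc] by blast
  \<comment> \<open>Consider a relation for \<open>1/q\<close> with top term
    \<open>t z [^] Suc j\<close>. If \<open>t = 0\<close>, the degree drops. Otherwise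
    \<open>t\<close> is invertible in \<open>F\<close>, and dividing by it gives a monic equation
    for \<open>z\<close> of degree \<open>Suc j \<le> d\<close>, against the minimality of
    \<open>d\<close>.\<close>
  have not_le: "inv q \<notin> poly_values T z j" if "j \<le> d" for j
    using that
  proof (induction j)
    case 0
    then show ?case using inv_q by simp
  next
    case (Suc j)
    show ?case
    proof
      assume "inv q \<in> poly_values T z (Suc j)"
      then obtain g t where gt: "inv q = g \<oplus> t \<otimes> z [^] Suc j" "g \<in> poly_values T z j" "t \<in> T"
        by auto
      have gc: "g \<in> carrier R" using poly_values_carrier[OF subring zc gt(2)] .
      have tc: "t \<in> carrier R" and zpc: "z [^] Suc j \<in> carrier R" using gt zc by auto
      have "t \<noteq> \<zero>"
      proof
        assume "t = \<zero>"
        then have "inv q = g" using gt gc zpc by simp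
        then show False using Suc gt by simp
      qed
      note it = nonzero_inv[OF tc this]
      have gF: "g \<in> poly_values F z j" 
        using gt(2) poly_values_subset[OF T_sub_F] by blast
      have iq: "inv q \<in> poly_values F z j"
        using poly_values_const[OF F_subring zc] F_inv[of q] q_nonzero by simp
      have "t \<otimes> z [^] Suc j = inv q \<ominus> g"
        unfolding gt(1) using gc tc zpc by algebra
      then have "inv t \<otimes> (t \<otimes> z [^] Suc j) = inv t \<otimes> (inv q \<oplus> \<ominus> g)"
        by (simp only: a_minus_def)
      then have "z [^] Suc j = inv t \<otimes> (inv q \<oplus> \<ominus> g)"
        using it tc zpc by (simp add: m_assoc[symmetric])
      also have "\<dots> \<in> poly_values F z j"
        by (rule poly_values_scale[OF F_subring zc poly_values_add[OF F_subring zc iq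
          poly_values_a_inv[OF F_subring zc gF]] F_inv[OF T_F[OF gt(3)] \<open>t \<noteq> \<zero>\<close>]])
      finally have "z [^] Suc j \<in> poly_values F z j" .
      then show False using min[of j z] Suc.prems zc zF zalg by simp
    qed
  qed
  have "adic_subring R q S"
  proof (intro adic_subring.intro[OF field_axioms] adic_subring_axioms.intro)
    show "inv q \<notin> S" using not_le[of d] S_le by blast
    fix a assume a: "a \<in> S" "a \<noteq> \<zero>"
    then have ac: "a \<in> carrier R" using subringE(1)[OF S] by blast
    note ia = nonzero_inv[OF ac a(2)]
    \<comment> \<open>The ring \<open>F[y]\<close> is a field because \<open>y\<close> is algebraic,
      so \<open>1/a\<close> exists there; a power of \<open>q\<close> brings it back into
      \<open>S\<close>.\<close>
    have "inv a \<in> simple_extension F y"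
      using subfield_m_inv(1)[OF Fy, of a] a SFy by blast
    then obtain m :: nat where m: "q [^] m \<otimes> inv a \<in> S"
      using simple_extension_rescale[OF y(1) z_def, of "inv a"] unfolding S_def by blast
    have "a \<otimes> (q [^] m \<otimes> inv a) = q [^] m"
      using ia ac m_lcomm[of a "q [^] m" "inv a"] by simp
    then show "\<exists>b\<in>S. \<exists>n::nat. a \<otimes> b = q [^] n" using m by blast
  qed (use S TS q_nonzero in auto)
  then have "S = T" using maximal TS by blast
  then show False using zS zF by simp
qed

end

section \<open>The Gauss extension and transcendental elements\<close>

context maximal_adic_subring
begin

text \<open>The maximal ideal of the valuation ring \<open>T\<close>. Zero is listed apart because
  \<open>inv \<zero>\<close> has no specified value.\<close>

definition nonunits where "nonunits = {t \<in> T. t \<noteq> \<zero> \<longrightarrow> inv t \<notin> T}"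

lemma nonunits_T: "t \<in> nonunits \<Longrightarrow> t \<in> T"
  by (simp add: nonunits_def)

lemma nonunits_carrier: "t \<in> nonunits \<Longrightarrow> t \<in> carrier R"
  using nonunits_T T_carrier by blast

lemma nonunits_zero: "\<zero> \<in> nonunits"
  by (simp add: nonunits_def)

lemma one_not_nonunits: "\<one> \<notin> nonunits"
  by (simp add: nonunits_def)

lemma q_nonunits: "q \<in> nonunits"
  using inv_q by (simp add: nonunits_def)

lemma inv_mult:
  assumes "a \<in> carrier R" "b \<in> carrier R" "a \<noteq> \<zero>" "b \<noteq> \<zero>"
  shows "inv (a \<otimes> b) = inv a \<otimes> inv b"
proof (rule comm_inv_char)
  note ia = nonzero_inv[OF assms(1,3)] and ib = nonzero_inv[OF assms(2,4)]
  show "a \<otimes> b \<otimes> (inv a \<otimes> inv b) = \<one>"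
    using assms ia ib m_assoc[of a b "inv a \<otimes> inv b"] m_lcomm[of b "inv a" "inv b"] by simp
qed (use assms nonzero_inv in auto)

lemma inv_quotient:
  assumes "a \<in> carrier R" "b \<in> carrier R" "a \<noteq> \<zero>" "b \<noteq> \<zero>"
  shows "inv (b \<otimes> inv a) = a \<otimes> inv b"
proof (rule comm_inv_char)
  note ia = nonzero_inv[OF assms(1,3)] and ib = nonzero_inv[OF assms(2,4)]
  have "b \<otimes> inv a \<otimes> (a \<otimes> inv b) = (inv a \<otimes> a) \<otimes> (b \<otimes> inv b)"
    using assms ia(1) ib(1) by algebra
  then show "b \<otimes> inv a \<otimes> (a \<otimes> inv b) = \<one>" using ia ib by simp
qed (use assms nonzero_inv in auto)

lemma nonunits_mult:
  assumes t: "t \<in> nonunits" and s: "s \<in> T"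
  shows "s \<otimes> t \<in> nonunits"
proof (rule ccontr)
  assume neg: "s \<otimes> t \<notin> nonunits"
  have c: "s \<in> carrier R" "t \<in> carrier R" using s t nonunits_carrier by auto
  have nz: "s \<otimes> t \<noteq> \<zero>" "inv (s \<otimes> t) \<in> T" using neg s nonunits_T[OF t] unfolding nonunits_def by auto
  then have nz': "s \<noteq> \<zero>" "t \<noteq> \<zero>" using c by auto
  note iu = nonzero_inv[OF c(1) nz'(1)] and it = nonzero_inv[OF c(2) nz'(2)]
  have "inv t = s \<otimes> inv (s \<otimes> t)"
    using c iu it by (simp add: inv_mult nz' m_assoc[symmetric])
  then have "inv t \<in> T" using s nz by simp
  then show False using t nz' unfolding nonunits_def by blast
qed

lemma nonunits_prime:
  assumes "s \<in> T" "s \<notin> nonunits" "t \<in> T" "t \<notin> nonunits"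
  shows "s \<otimes> t \<notin> nonunits"
proof -
  have nz: "s \<noteq> \<zero>" "t \<noteq> \<zero>" "inv s \<in> T" "inv t \<in> T" using assms unfolding nonunits_def by auto
  have c: "s \<in> carrier R" "t \<in> carrier R" using assms by auto
  have "inv (s \<otimes> t) \<in> T" using nz by (simp add: inv_mult c)
  then show ?thesis using nz c unfolding nonunits_def by (simp add: integral_iff)
qed

text \<open>By \<open>valuation_dichotomy\<close> one of \<open>b/a\<close> and \<open>a/b\<close>
  lies in \<open>T\<close>, so the sum is a multiple in \<open>T\<close> of \<open>a\<close> or of
  \<open>b\<close>.\<close>

lemma nonunits_add:
  assumes a: "a \<in> nonunits" and b: "b \<in> nonunits"
  shows "a \<oplus> b \<in> nonunits"
proof (cases "a = \<zero> \<or> b = \<zero>")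
  case True
  then show ?thesis using a b nonunits_carrier by auto
next
  case False
  have c: "a \<in> carrier R" "b \<in> carrier R" using a b nonunits_carrier by auto
  note ia = nonzero_inv[OF c(1)] and ib = nonzero_inv[OF c(2)]
  have F: "b \<otimes> inv a \<in> F" "b \<otimes> inv a \<noteq> \<zero>"
    using False a b ia c F_inv[of a] nonunits_T T_F by (auto simp: integral_iff)
  have "inv (b \<otimes> inv a) = a \<otimes> inv b"
    using False inv_quotient[OF c] by blast
  then consider "b \<otimes> inv a \<in> T" | "a \<otimes> inv b \<in> T" using valuation_dichotomy[OF F] by auto
  then show ?thesis
  proof cases
    case 1
    have "a \<oplus> b = (\<one> \<oplus> b \<otimes> inv a) \<otimes> a"
      using False c ia by (simp add: l_distr m_assoc)
    then show ?thesis using nonunits_mult[OF a] 1 by simp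
  next
    case 2
    have "a \<oplus> b = (a \<otimes> inv b \<oplus> \<one>) \<otimes> b"
      using False c ib by (simp add: l_distr m_assoc)
    then show ?thesis using nonunits_mult[OF b] 2 by simp
  qed
qed

lemma nonunits_finsum: "finite A \<Longrightarrow> (\<And>k. k \<in> A \<Longrightarrow> h k \<in> nonunits) \<Longrightarrow> finsum R h A \<in> nonunits"
proof (induction A rule: finite_induct)
  case empty
  then show ?case by (simp add: nonunits_zero)
next
  case (insert k A)
  have "h \<in> A \<rightarrow> carrier R" "h k \<in> carrier R" using insert nonunits_carrier by auto
  then show ?case using insert nonunits_add by simp
qed

text \<open>The polynomials of Gauss valuation zero. Over a valuation ring, having content one means
  that some coefficient is a unit.\<close>

definition primitive where
  "primitive f \<longleftrightarrow> f \<in> carrier (T[X]) \<and> (\<exists>i. coeff f i \<notin> nonunits)"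

lemma T_poly_coeff: "f \<in> carrier (T[X]) \<Longrightarrow> coeff f i \<in> T"
  using coeff_img(3)[of f] polynomial_incl[of T f] univ_poly_carrier[of R T f] T_simps(1)
  by (metis (no_types, lifting) Un_iff rangeI singletonD subsetD)

lemma T_poly_set: "f \<in> carrier (T[X]) \<Longrightarrow> set f \<subseteq> T"
  using polynomial_incl[of T f] univ_poly_carrier[of R T f] by simp

text \<open>Gauss's lemma. Let \<open>i\<close> and \<open>j\<close> be the lowest indices of unit
  coefficients. In the coefficient of the product at \<open>i + j\<close>, every summand but one has
  a factor of index below \<open>i\<close> or below \<open>j\<close>, hence is a nonunit, and the
  remaining one is a product of units.\<close>

lemma primitive_mult:
  assumes f: "primitive f" and g: "primitive g"
  shows "primitive (f \<otimes>\<^bsub>T[X]\<^esub> g)"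
proof -
  have fg: "f \<in> carrier (T[X])" "g \<in> carrier (T[X])" using f g unfolding primitive_def by auto
  have set: "set f \<subseteq> carrier R" "set g \<subseteq> carrier R" using T_poly_set[OF fg(1)] T_poly_set[OF fg(2)] T_subset by blast+
  define i j where "i = (LEAST i. coeff f i \<notin> nonunits)" and "j = (LEAST j. coeff g j \<notin> nonunits)"
  have i: "coeff f i \<notin> nonunits" unfolding i_def using f unfolding primitive_def by (metis (mono_tags, lifting) LeastI_ex)
  have j: "coeff g j \<notin> nonunits" unfolding j_def using g unfolding primitive_def by (metis (mono_tags, lifting) LeastI_ex)
  have less_i: "coeff f k \<in> nonunits" if "k < i" for k using not_less_Least that unfolding i_def by blast
  have less_j: "coeff g k \<in> nonunits" if "k < j" for k using not_less_Least that unfolding j_def by blast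
  let ?h = "\<lambda>k. coeff f k \<otimes> coeff g (i + j - k)"
  have hT: "?h k \<in> T" for k using T_poly_coeff fg by simp
  let ?r = "finsum R ?h ({..i+j} - {i})"
  have r: "?r \<in> nonunits"
  proof (rule nonunits_finsum)
    fix k assume k: "k \<in> {..i + j} - {i}"
    show "?h k \<in> nonunits"
    proof (cases "k < i")
      case True
      then show ?thesis
        using nonunits_mult[OF less_i[OF True] T_poly_coeff[OF fg(2), of "i + j - k"]] m_comm
          T_poly_coeff fg by simp
    next
      case False
      then have "i + j - k < j" using k by auto
      then show ?thesis using nonunits_mult[OF less_j T_poly_coeff[OF fg(1)]] by blast
    qed
  qed simp
  have "coeff (f \<otimes>\<^bsub>T[X]\<^esub> g) (i + j) = finsum R ?h {..i+j}"
    using poly_mult_coeff[OF set] by (simp add: univ_poly_mult)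
  also have "{..i+j} = insert i ({..i+j} - {i})" by auto
  also have "finsum R ?h \<dots> = ?h i \<oplus> ?r"
    by (intro finsum_insert Pi_I T_carrier[OF hT]) auto
  finally have eq: "coeff (f \<otimes>\<^bsub>T[X]\<^esub> g) (i + j) = ?h i \<oplus> ?r" .
  have "?h i \<oplus> ?r \<notin> nonunits"
  proof
    assume a: "?h i \<oplus> ?r \<in> nonunits"
    have c: "?h i \<in> carrier R" "?r \<in> carrier R" using hT T_carrier nonunits_carrier[OF r] by blast+
    have "?h i = (?h i \<oplus> ?r) \<oplus> (\<ominus> \<one>) \<otimes> ?r"
      using c by (simp add: l_minus a_assoc r_neg)
    moreover have "\<dots> \<in> nonunits" using nonunits_add[OF a nonunits_mult[OF r]] by simp
    ultimately show False
      using nonunits_prime[OF T_poly_coeff[OF fg(1)] i T_poly_coeff[OF fg(2)] j] by simp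
  qed
  then show ?thesis
    unfolding primitive_def eq[symmetric]
    using monoid.m_closed[OF ring.is_monoid[OF univ_poly_is_ring[OF subring]] fg] by blast
qed

text \<open>Divisibility in a valuation ring is total, so a running candidate of least valuation can
  be kept: the new element \<open>a\<close> replaces \<open>c\<close> exactly when \<open>c\<close>
  does not divide it.\<close>

lemma exists_common_divisor:
  "set ts \<subseteq> T \<Longrightarrow> \<exists>t\<in>set ts. t \<noteq> \<zero> \<Longrightarrow>
    \<exists>c\<in>set ts. c \<noteq> \<zero> \<and> (\<forall>t\<in>set ts. inv c \<otimes> t \<in> T)"
proof (induction ts)
  case Nil
  then show ?case by simp
next
  case (Cons a ts)
  have aT: "a \<in> T" and ac: "a \<in> carrier R" using Cons.prems by auto
  note ia = nonzero_inv[OF ac]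
  show ?case
  proof (cases "\<exists>t\<in>set ts. t \<noteq> \<zero>")
    case False
    then have "a \<noteq> \<zero>" using Cons.prems by auto
    then show ?thesis using False ia ac by (intro bexI[of _ a]) auto
  next
    case True
    then obtain c where c: "c \<in> set ts" "c \<noteq> \<zero>" "\<And>t. t \<in> set ts \<Longrightarrow> inv c \<otimes> t \<in> T"
      using Cons by auto
    have cT: "c \<in> T" and cc: "c \<in> carrier R" using c Cons.prems by auto
    note ic = nonzero_inv[OF cc c(2)]
    show ?thesis
    proof (cases "inv c \<otimes> a \<in> T")
      case True
      then show ?thesis using c by (intro bexI[of _ c]) auto
    next
      case notT: False
      then have a0: "a \<noteq> \<zero>" using ic by auto
      note ia = nonzero_inv[OF ac a0]
      have "inv c \<otimes> a \<in> F" "inv c \<otimes> a \<noteq> \<zero>"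
        using F_inv[of c] cT aT c(2) a0 ac ic by (auto simp: integral_iff)
      moreover have "inv (inv c \<otimes> a) = inv a \<otimes> c"
        using inv_quotient[OF cc ac c(2) a0] m_comm ic(1) ia(1) ac cc by simp
      ultimately have acT: "inv a \<otimes> c \<in> T" using valuation_dichotomy notT by metis
      have "inv a \<otimes> t \<in> T" if "t \<in> set ts" for t
      proof -
        have tc: "t \<in> carrier R" using that Cons.prems by auto
        have "(inv a \<otimes> c) \<otimes> (inv c \<otimes> t) = (c \<otimes> inv c) \<otimes> (inv a \<otimes> t)"
          using ia(1) ic(1) cc tc by algebra
        then have "inv a \<otimes> t = (inv a \<otimes> c) \<otimes> (inv c \<otimes> t)"
          using ia ic tc by simp
        then show ?thesis using acT c(3)[OF that] by simp
      qed
      then show ?thesis using ia a0 by (intro bexI[of _ a]) auto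
    qed
  qed
qed

lemma eval_scale:
  assumes "x \<in> carrier R" "a \<in> carrier R"
  shows "set f \<subseteq> carrier R \<Longrightarrow> eval (map (\<lambda>t. a \<otimes> t) f) x = a \<otimes> eval f x"
  by (induction f) (use assms eval_in_carrier in \<open>auto simp: r_distr m_assoc\<close>)

lemma scale_T_poly:
  assumes "f \<in> carrier (T[X])" "\<And>t. t \<in> set f \<Longrightarrow> a \<otimes> t \<in> T" "a \<in> carrier R" "a \<noteq> \<zero>"
  shows "map (\<lambda>t. a \<otimes> t) f \<in> carrier (T[X])"
proof (cases f)
  case Nil
  then show ?thesis by (simp add: univ_poly_zero_closed)
next
  case (Cons l ts)
  have "polynomial T f" using assms(1) by (simp add: univ_poly_carrier)
  then have "l \<noteq> \<zero>" "l \<in> T" using Cons unfolding polynomial_def by auto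
  then have "a \<otimes> l \<noteq> \<zero>" using assms by (simp add: integral_iff)
  then have "polynomial T (map (\<lambda>t. a \<otimes> t) f)"
    unfolding polynomial_def using assms(2) Cons by auto
  then show ?thesis by (simp add: univ_poly_carrier)
qed

text \<open>Dividing by a coefficient of least valuation keeps all coefficients in \<open>T\<close>
  and turns that one into \<open>\<one>\<close>.\<close>

lemma content_primitive_part:
  assumes f: "f \<in> carrier (T[X])" "f \<noteq> []" and x: "x \<in> carrier R"
  shows "\<exists>c\<in>T. \<exists>f'. c \<noteq> \<zero> \<and> primitive f' \<and> eval f x = c \<otimes> eval f' x"
proof -
  have pol: "polynomial T f" using f(1) by (simp add: univ_poly_carrier)
  then have "hd f \<noteq> \<zero>" "hd f \<in> set f" using f(2) unfolding polynomial_def by auto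
  then obtain c where c: "c \<in> set f" "c \<noteq> \<zero>" "\<And>t. t \<in> set f \<Longrightarrow> inv c \<otimes> t \<in> T"
    using exists_common_divisor[OF T_poly_set[OF f(1)]] by blast
  have cT: "c \<in> T" using c T_poly_set[OF f(1)] by blast
  then have cc: "c \<in> carrier R" by simp
  note ic = nonzero_inv[OF cc c(2)]
  let ?f = "map (\<lambda>t. inv c \<otimes> t) f"
  have fc: "set f \<subseteq> carrier R" using T_poly_set[OF f(1)] T_subset by blast
  obtain i where "coeff f i = c" using c(1) coeff_img(1)[of f] by (metis imageE)
  then have "coeff ?f i = \<one>" using scalar_coeff[OF ic(1), of f] ic by simp
  then have "primitive ?f"
    unfolding primitive_def using scale_T_poly[OF f(1) c(3) ic(1,4)] one_not_nonunits by metis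
  moreover have "eval f x = c \<otimes> eval ?f x"
    using eval_scale[OF x ic(1) fc] eval_in_carrier[OF fc x] ic cc by (simp add: m_assoc[symmetric])
  ultimately show ?thesis using cT c(2) by blast
qed

text \<open>The Gauss extension of \<open>T\<close> to \<open>F(x)\<close>.\<close>

lemma transcendental_imp_mem:
  assumes x: "x \<in> carrier R" and tr: "(transcendental over F) x"
  shows "x \<in> T"
proof -
  have tr_T: "(transcendental over T) x" using transcendental_mono[OF T_sub_F tr] .
  interpret E: ring_hom_cring "T[X]" R "\<lambda>p. eval p x" using eval_cring_hom[OF subring x] .
  have P1: "primitive \<one>\<^bsub>T[X]\<^esub>"
    unfolding primitive_def using one_not_nonunits monoid.one_closed[OF ring.is_monoid[OF univ_poly_is_ring[OF subring]]]
    by (auto simp: univ_poly_one intro!: exI[of _ 0])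
  have prim_closed: "g \<in> carrier (T[X])" if "primitive g" for g using that by (simp add: primitive_def)
  have prim_nz: "eval g x \<noteq> \<zero>" if "primitive g" for g
  proof
    assume "eval g x = \<zero>"
    then have "g = []" using eval_transcendental[OF tr_T prim_closed[OF that]] by blast
    then show False using that nonunits_zero by (simp add: primitive_def)
  qed
  \<comment> \<open>The fractions \<open>f(x)/g(x)\<close> with \<open>g\<close> primitive are the
    elements of \<open>F(x)\<close> of nonnegative Gauss valuation. By \<open>primitive_mult\<close>
    the admissible denominators are closed under products.\<close>
  define S where "S = {a \<in> carrier R. \<exists>f\<in>carrier (T[X]). \<exists>g. primitive g \<and> a \<otimes> eval g x = eval f x}"
  have S_I: "a \<in> S" if "a \<in> carrier R" "f \<in> carrier (T[X])" "primitive g" "a \<otimes> eval g x = eval f x" for a f g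
    using that unfolding S_def by blast
  have ext_S: "simple_extension T x \<subseteq> S"
  proof
    fix s assume "s \<in> simple_extension T x"
    then obtain f where f: "f \<in> carrier (T[X])" "s = eval f x"
      using simple_extension_as_eval_img[OF T_subset x] by blast
    then have "s \<otimes> eval \<one>\<^bsub>T[X]\<^esub> x = eval f x" using E.hom_one by simp
    then show "s \<in> S" using S_I[OF _ f(1) P1] f E.hom_closed by blast
  qed
  have TS: "T \<subseteq> S" using ext_S simple_extension_incl[OF T_subset x] by blast
  have xS: "x \<in> S" using ext_S simple_extension_mem[OF subring x] by blast
  have S: "subring S R"
  proof (rule subringI)
    show "S \<subseteq> carrier R" unfolding S_def by blast
    show "\<one> \<in> S" using TS by auto
  next
    fix a assume "a \<in> S"
    then obtain f g where a: "a \<in> carrier R" "f \<in> carrier (T[X])" "primitive g" "a \<otimes> eval g x = eval f x"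
      unfolding S_def by blast
    have "(\<ominus> a) \<otimes> eval g x = eval (\<ominus>\<^bsub>T[X]\<^esub> f) x"
      using a E.hom_closed[OF prim_closed[OF a(3)]] by (simp add: l_minus)
    then show "\<ominus> a \<in> S" using S_I[of "\<ominus> a" "\<ominus>\<^bsub>T[X]\<^esub> f" g] a by simp
  next
    fix a b assume "a \<in> S" "b \<in> S"
    then obtain f g f' g' where a: "a \<in> carrier R" "f \<in> carrier (T[X])" "primitive g" "a \<otimes> eval g x = eval f x"
      and b: "b \<in> carrier R" "f' \<in> carrier (T[X])" "primitive g'" "b \<otimes> eval g' x = eval f' x"
      unfolding S_def by blast
    note gc = prim_closed[OF a(3)] prim_closed[OF b(3)]
    note ec = E.hom_closed[OF gc(1)] E.hom_closed[OF gc(2)]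
    note pm = primitive_mult[OF a(3) b(3)]
    have "(a \<otimes> b) \<otimes> (eval g x \<otimes> eval g' x) = (a \<otimes> eval g x) \<otimes> (b \<otimes> eval g' x)"
      using a(1) b(1) ec by algebra
    then have "(a \<otimes> b) \<otimes> eval (g \<otimes>\<^bsub>T[X]\<^esub> g') x = eval (f \<otimes>\<^bsub>T[X]\<^esub> f') x"
      using a(2,4) b(2,4) gc by (simp add: E.hom_mult)
    then show "a \<otimes> b \<in> S" using S_I[OF _ _ pm, of "a \<otimes> b" "f \<otimes>\<^bsub>T[X]\<^esub> f'"] a b by simp
    have "(a \<oplus> b) \<otimes> (eval g x \<otimes> eval g' x)
      = (a \<otimes> eval g x) \<otimes> eval g' x \<oplus> (b \<otimes> eval g' x) \<otimes> eval g x"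
      using a(1) b(1) ec by algebra
    then have "(a \<oplus> b) \<otimes> eval (g \<otimes>\<^bsub>T[X]\<^esub> g') x
      = eval (f \<otimes>\<^bsub>T[X]\<^esub> g' \<oplus>\<^bsub>T[X]\<^esub> f' \<otimes>\<^bsub>T[X]\<^esub> g) x"
      using a(2,4) b(2,4) gc by (simp add: E.hom_mult E.hom_add)
    then show "a \<oplus> b \<in> S"
      using S_I[OF _ _ pm, of "a \<oplus> b" "f \<otimes>\<^bsub>T[X]\<^esub> g' \<oplus>\<^bsub>T[X]\<^esub> f' \<otimes>\<^bsub>T[X]\<^esub> g"] a b gc by simp
  qed
  note iq = nonzero_inv[OF q_carrier q_nonzero]
  have "adic_subring R q S"
  proof (intro adic_subring.intro[OF field_axioms] adic_subring_axioms.intro)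
    show "inv q \<notin> S"
    proof
      assume "inv q \<in> S"
      then obtain f g where a: "f \<in> carrier (T[X])" "primitive g" "inv q \<otimes> eval g x = eval f x"
        unfolding S_def by blast
      note gc = prim_closed[OF a(2)]
      have fc: "set f \<subseteq> carrier R" using T_poly_set[OF a(1)] T_subset by blast
      \<comment> \<open>Transcendence lifts \<open>g(x) = q f(x)\<close> to \<open>g = q f\<close>
        as polynomials. Then all coefficients of \<open>g\<close> are multiples of the nonunit
        \<open>q\<close>, so \<open>g\<close> is not primitive.\<close>
      let ?h = "map (\<lambda>t. q \<otimes> t) f"
      have h: "?h \<in> carrier (T[X])"
        using T_poly_set[OF a(1)] by (intro scale_T_poly[OF a(1) _ q_carrier q_nonzero]) auto
      have "q \<otimes> (inv q \<otimes> eval g x) = eval ?h x"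
        unfolding eval_scale[OF x q_carrier fc] a(3) ..
      then have "eval g x = eval ?h x"
        using iq E.hom_closed[OF gc] by (simp add: m_assoc[symmetric])
      then have "g = ?h"
        using tr_T gc h unfolding over_def transcendental_def by (meson inj_onD)
      then have "coeff g i = q \<otimes> coeff f i" for i
        using scalar_coeff[OF q_carrier, of f] by simp
      then have "coeff g i \<in> nonunits" for i
        using nonunits_mult[OF q_nonunits T_poly_coeff[OF a(1), of i]] T_poly_coeff[OF a(1), of i] m_comm by simp
      then show False using a(2) unfolding primitive_def by blast
    qed
    fix a assume aS: "a \<in> S" and a0: "a \<noteq> \<zero>"
    then obtain f g where a: "a \<in> carrier R" "f \<in> carrier (T[X])" "primitive g" "a \<otimes> eval g x = eval f x"
      unfolding S_def by blast
    note gc = prim_closed[OF a(3)]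
    note ec = E.hom_closed[OF gc]
    have "eval f x \<noteq> \<zero>" using a a0 ec prim_nz[OF a(3)] integral_iff by metis
    then have "f \<noteq> []" by auto
    then obtain c f' where c: "c \<in> T" "c \<noteq> \<zero>" "primitive f'" "eval f x = c \<otimes> eval f' x"
      using content_primitive_part[OF a(2) _ x] by blast
    obtain c' and n :: nat where c': "c' \<in> T" "c \<otimes> c' = q [^] n" using cofactor[OF c(1,2)] by blast
    have cc: "c \<in> carrier R" "c' \<in> carrier R" using c c' by auto
    have "c' \<noteq> \<zero>" using c'(2) q_pow_nonzero[of n] cc by auto
    have e'c: "eval f' x \<in> carrier R" using E.hom_closed[OF prim_closed[OF c(3)]] .
    note ie = nonzero_inv[OF e'c prim_nz[OF c(3)]]
    \<comment> \<open>As \<open>a = c f'(x)/g(x)\<close> and \<open>c c' = q [^] n\<close>, the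
      cofactor of \<open>a\<close> must be \<open>c' g(x)/f'(x)\<close>. It lies in \<open>S\<close>
      because its denominator \<open>f'\<close> is primitive; this is why the content
      \<open>c\<close> was split off.\<close>
    define b where "b = c' \<otimes> eval g x \<otimes> inv (eval f' x)"
    have bc: "b \<in> carrier R" unfolding b_def using cc ec ie by simp
    have gset: "set g \<subseteq> carrier R" using T_poly_set[OF gc] T_subset by blast
    have "b \<otimes> eval f' x = eval (map (\<lambda>t. c' \<otimes> t) g) x"
      unfolding eval_scale[OF x cc(2) gset] b_def using cc ec ie e'c by (simp add: m_assoc)
    moreover have "map (\<lambda>t. c' \<otimes> t) g \<in> carrier (T[X])"
      using T_poly_set[OF gc] c' by (intro scale_T_poly[OF gc _ cc(2) \<open>c' \<noteq> \<zero>\<close>]) auto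
    ultimately have "b \<in> S" using S_I[OF bc _ c(3)] by blast
    moreover have "a \<otimes> b = q [^] n"
    proof -
      have "a \<otimes> b = c' \<otimes> (a \<otimes> eval g x) \<otimes> inv (eval f' x)"
        unfolding b_def using cc ec ie(1) a(1) by algebra
      also have "\<dots> = (c \<otimes> c') \<otimes> (eval f' x \<otimes> inv (eval f' x))"
        unfolding a(4) c(4) using cc e'c ie(1) by algebra
      also have "\<dots> = q [^] n" using c' ie by simp
      finally show ?thesis .
    qed
    ultimately show "\<exists>b\<in>S. \<exists>n::nat. a \<otimes> b = q [^] n" by blast
  qed (use S TS q_nonzero in auto)
  then have "S = T" using maximal TS by blast
  then show ?thesis using xS by simp
qed

lemma F_eq_carrier: "F = carrier R"
proof
  show "carrier R \<subseteq> F"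
  proof
    fix x assume x: "x \<in> carrier R"
    show "x \<in> F"
    proof (cases "(transcendental over F) x")
      case True
      \<comment> \<open>Membership in \<open>T\<close> contradicts transcendence over
        \<open>F\<close>, so this case is in fact void; membership is all that the inclusion asks
        for.\<close>
      then show ?thesis using transcendental_imp_mem[OF x] by simp
    next
      case False
      then show ?thesis using algebraic_imp_mem[OF x] by (simp add: over_def)
    qed
  qed
qed auto

end

section \<open>Maximal subrings from homomorphisms to fields of characteristic zero\<close>

lemma (in ring) chain_Union_subring:
  assumes "C \<noteq> {}" "subset.chain A C" "\<And>S. S \<in> A \<Longrightarrow> subring S R"
  shows "subring (\<Union>C) R"
proof -
  have sub: "subring S R" if "S \<in> C" for S
    using assms(2,3) that unfolding pred_on.chain_def by blast
  have common: "\<exists>S\<in>C. x \<in> S \<and> y \<in> S" if "x \<in> \<Union>C" "y \<in> \<Union>C" for x y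
    using that assms(2) unfolding pred_on.chain_def by blast
  show ?thesis
  proof (rule subringI)
    show "\<Union>C \<subseteq> carrier R" using subringE(1)[OF sub] by blast
    show "\<one> \<in> \<Union>C" using subringE(3)[OF sub] assms(1) by blast
    show "\<ominus> x \<in> \<Union>C" if "x \<in> \<Union>C" for x using subringE(5)[OF sub] that by blast
    show "x \<otimes> y \<in> \<Union>C" if "x \<in> \<Union>C" "y \<in> \<Union>C" for x y
      using subringE(6)[OF sub] common[OF that] by blast
    show "x \<oplus> y \<in> \<Union>C" if "x \<in> \<Union>C" "y \<in> \<Union>C" for x y
      using subringE(7)[OF sub] common[OF that] by blast
  qed
qed

text \<open>A cofactor found in one member of a chain still serves in the union, and
  \<open>1/q\<close> lies in the union only if it lies in a member.\<close>

lemma (in adic_subring) exists_maximal_adic_subring: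
  "\<exists>S. maximal_adic_subring R q S"
proof -
  let ?A = "{S. adic_subring R q S}"
  have "\<exists>S\<in>?A. \<forall>V\<in>?A. S \<subseteq> V \<longrightarrow> V = S"
  proof (rule subset_Zorn_nonempty)
    show "?A \<noteq> {}" using adic_subring_axioms by blast
  next
    fix C assume C: "C \<noteq> {}" "subset.chain ?A C"
    then have adic: "\<And>S. S \<in> C \<Longrightarrow> adic_subring R q S" unfolding pred_on.chain_def by blast
    have sub: "subring (\<Union>C) R"
      by (rule chain_Union_subring[OF C]) (auto dest: adic_subring.subring)
    have "adic_subring R q (\<Union>C)"
    proof (intro adic_subring.intro[OF field_axioms] adic_subring_axioms.intro)
      show "q \<in> \<Union>C" using C(1) adic_subring.q_mem[OF adic] by blast
      show "inv q \<notin> \<Union>C" using adic_subring.inv_q[OF adic] by blast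
      fix a assume "a \<in> \<Union>C" "a \<noteq> \<zero>"
      then obtain S where S: "S \<in> C" "a \<in> S" "a \<noteq> \<zero>" by blast
      then show "\<exists>b\<in>\<Union>C. \<exists>n::nat. a \<otimes> b = q [^] n"
        using adic_subring.cofactor[OF adic[OF S(1)] S(2,3)] by blast
    qed (use sub q_nonzero in auto)
    then show "\<Union>C \<in> ?A" by blast
  qed
  then obtain S where "S \<in> ?A" "\<forall>V\<in>?A. S \<subseteq> V \<longrightarrow> V = S" by (rule bexE)
  then have "maximal_adic_subring R q S"
    by (intro maximal_adic_subring.intro maximal_adic_subring_axioms.intro) simp_all
  then show ?thesis by blast
qed

section \<open>The integers localized at \<open>p\<close> as a starting subring\<close>

context ring
begin

abbreviation int_embed :: "int \<Rightarrow> 'a" where "int_embed k \<equiv> [k] \<cdot> \<one>"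

lemma int_embed_zero [simp]: "int_embed 0 = \<zero>"
  by (simp add: add_pow_int_ge)

lemma int_embed_add: "int_embed (k + l) = int_embed k \<oplus> int_embed l"
  using add.int_pow_mult by simp

lemma int_embed_mult: "int_embed (k * l) = int_embed k \<otimes> int_embed l"
  using add.int_pow_pow[of \<one> k l] add_pow_ldistr_int[of \<one> "int_embed l" k] by (simp add: mult.commute)

lemma int_embed_uminus: "int_embed (- k) = \<ominus> int_embed k"
  using add.int_pow_neg[of \<one> k] unfolding a_inv_def by simp

lemma int_embed_nat: "int_embed (int n) = [n] \<cdot> \<one>"
  by (simp add: add_pow_int_ge)

lemma nat_embed_mult: "[(n * m)] \<cdot> \<one> = [n] \<cdot> \<one> \<otimes> [m] \<cdot> \<one>" for n m :: nat
  using int_embed_mult[of "int n" "int m"] by (simp add: int_embed_nat flip: of_nat_mult)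

lemma int_embed_power: "int_embed (k ^ n) = int_embed k [^] n"
proof (induction n)
  case 0
  show ?case by simp
next
  case (Suc n)
  then show ?case by (simp only: power_Suc2 int_embed_mult nat_pow_Suc)
qed

end

lemma (in field) exists_adic_subring:
  assumes char: "\<And>n::nat. 0 < n \<Longrightarrow> [n] \<cdot> \<one> \<noteq> \<zero>"
    and p: "Factorial_Ring.prime (p :: nat)"
  shows "\<exists>T. adic_subring R ([p] \<cdot> \<one>) T"
proof -
  have embed_nz: "int_embed k \<noteq> \<zero>" if "k \<noteq> 0" for k
  proof (cases "k > 0")
    case True
    then show ?thesis using char[of "nat k"] add_pow_int_ge[of k R \<one>] by simp
  next
    case False
    then have "[nat (- k)] \<cdot> \<one> \<noteq> \<zero>" using char that by simp
    then show ?thesis using False that add_pow_int_lt[of k R \<one>] by auto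
  qed
  have inj: "k = l" if "int_embed k = int_embed l" for k l
  proof (rule ccontr)
    assume "k \<noteq> l"
    then have "int_embed (k + - l) \<noteq> \<zero>" using embed_nz by simp
    then show False using that unfolding int_embed_add int_embed_uminus by (simp add: r_neg)
  qed
  have pp: "Factorial_Ring.prime (int p)" using p by simp
  \<comment> \<open>The fractions \<open>k/m\<close> with \<open>m\<close> prime to
    \<open>p\<close>, written as \<open>m a = k\<close>; in characteristic zero this is a copy of
    the integers localized at \<open>p\<close>.\<close>
  define T where "T = {a \<in> carrier R. \<exists>m k. \<not> int p dvd m \<and> int_embed m \<otimes> a = int_embed k}"
  have T_I: "a \<in> T" if "a \<in> carrier R" "\<not> int p dvd m" "int_embed m \<otimes> a = int_embed k" for a m k
    using that unfolding T_def by blast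
  have int_T: "int_embed k \<in> T" for k
    using T_I[of "int_embed k" 1 k] prime_gt_1_nat[OF p] by simp
  have "subring T R"
  proof (rule subringI)
    show "T \<subseteq> carrier R" unfolding T_def by blast
    show "\<one> \<in> T" using int_T[of 1] by simp
  next
    fix a assume "a \<in> T"
    then obtain m k where a: "a \<in> carrier R" "\<not> int p dvd m" "int_embed m \<otimes> a = int_embed k"
      unfolding T_def by blast
    then show "\<ominus> a \<in> T" using T_I[of "\<ominus> a" m "- k"] by (simp add: r_minus int_embed_uminus)
  next
    fix a b assume "a \<in> T" "b \<in> T"
    then obtain m k m' k' where a: "a \<in> carrier R" "\<not> int p dvd m" "int_embed m \<otimes> a = int_embed k"
      and b: "b \<in> carrier R" "\<not> int p dvd m'" "int_embed m' \<otimes> b = int_embed k'"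
      unfolding T_def by blast
    have mm: "\<not> int p dvd m * m'" using a b pp by (simp add: prime_dvd_mult_iff)
    have c: "int_embed m \<in> carrier R" "int_embed m' \<in> carrier R" by auto
    have "int_embed (m * m') \<otimes> (a \<otimes> b) = (int_embed m \<otimes> a) \<otimes> (int_embed m' \<otimes> b)"
      unfolding int_embed_mult using a(1) b(1) c by algebra
    also have "\<dots> = int_embed (k * k')" unfolding a(3) b(3) int_embed_mult ..
    finally show "a \<otimes> b \<in> T" using T_I[OF _ mm] a(1) b(1) by simp
    have "int_embed (m * m') \<otimes> (a \<oplus> b)
      = int_embed m' \<otimes> (int_embed m \<otimes> a) \<oplus> int_embed m \<otimes> (int_embed m' \<otimes> b)"
      unfolding int_embed_mult using a(1) b(1) c by algebra
    also have "\<dots> = int_embed (m' * k + m * k')" unfolding a(3) b(3) int_embed_mult int_embed_add ..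
    finally show "a \<oplus> b \<in> T" using T_I[OF _ mm] a(1) b(1) by simp
  qed
  moreover have q: "[p] \<cdot> \<one> = int_embed (int p)" by (simp add: int_embed_nat)
  moreover have "inv (int_embed (int p)) \<notin> T"
  proof
    assume "inv (int_embed (int p)) \<in> T"
    then obtain m k where mk: "\<not> int p dvd m" "int_embed m \<otimes> inv (int_embed (int p)) = int_embed k"
      unfolding T_def by blast
    have nz: "int_embed (int p) \<noteq> \<zero>" using embed_nz[of "int p"] p by (simp add: prime_gt_0_nat)
    note ip = nonzero_inv[OF _ nz]
    have "int_embed m = int_embed m \<otimes> inv (int_embed (int p)) \<otimes> int_embed (int p)"
      using ip by (simp add: m_assoc)
    then have "int_embed m = int_embed (k * int p)" unfolding mk(2) int_embed_mult .
    then have "m = k * int p" by (rule inj)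
    then show False using mk by simp
  qed
  moreover have "\<exists>b\<in>T. \<exists>n::nat. a \<otimes> b = int_embed (int p) [^] n" if "a \<in> T" "a \<noteq> \<zero>" for a
  proof -
    obtain m k where a: "a \<in> carrier R" "\<not> int p dvd m" "int_embed m \<otimes> a = int_embed k"
      using \<open>a \<in> T\<close> unfolding T_def by blast
    have "m \<noteq> 0" using a by auto
    then have "k \<noteq> 0" using a embed_nz \<open>a \<noteq> \<zero>\<close> integral_iff[of "int_embed m" a] by auto
    define n where "n = multiplicity (int p) k"
    have "\<not> is_unit (int p)" using pp not_prime_unit by blast
    then obtain l where l: "k = int p ^ n * l" "\<not> int p dvd l"
      unfolding n_def by (rule multiplicity_decompose'[OF \<open>k \<noteq> 0\<close>])
    have lnz: "int_embed l \<noteq> \<zero>" using embed_nz[of l] l(2) by auto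
    have lc: "int_embed l \<in> carrier R" and mc: "int_embed m \<in> carrier R" by auto
    note il = nonzero_inv[OF lc lnz]
    \<comment> \<open>With \<open>a = p [^] n l / m\<close> and both \<open>l\<close> and
      \<open>m\<close> prime to \<open>p\<close>, the cofactor is \<open>m / l\<close>.\<close>
    define b where "b = inv (int_embed l) \<otimes> int_embed m"
    have bc: "b \<in> carrier R" unfolding b_def using il by simp
    have "int_embed l \<otimes> b = int_embed m" unfolding b_def using il by (simp add: m_assoc[symmetric])
    then have "b \<in> T" using T_I[OF bc l(2)] by blast
    moreover have "a \<otimes> b = int_embed (int p) [^] n"
    proof -
      have "a \<otimes> b = inv (int_embed l) \<otimes> (int_embed m \<otimes> a)"
        unfolding b_def using il(1) a(1) mc by algebra
      also have "\<dots> = int_embed (int p) [^] n"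
        unfolding a(3) l(1) int_embed_mult int_embed_power
        using il lc m_lcomm[of "inv (int_embed l)" "int_embed (int p) [^] n" "int_embed l"] by simp
      finally show ?thesis .
    qed
    ultimately show ?thesis by blast
  qed
  ultimately have "adic_subring R ([p] \<cdot> \<one>) T"
    using int_T[of "int p"] char[of p] p
    by (intro adic_subring.intro[OF field_axioms] adic_subring_axioms.intro) (auto simp: prime_gt_0_nat)
  then show ?thesis by blast
qed

lemma (in field) exists_subring_inverting_prime:
  assumes char: "\<And>n::nat. 0 < n \<Longrightarrow> [n] \<cdot> \<one> \<noteq> \<zero>"
    and p: "Factorial_Ring.prime (p :: nat)"
  obtains T where "subring T R" "inv ([p] \<cdot> \<one>) \<notin> T"
    "\<And>x. x \<in> carrier R \<Longrightarrow> \<exists>n::nat. ([p] \<cdot> \<one>) [^] n \<otimes> x \<in> T"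
proof -
  obtain T0 where "adic_subring R ([p] \<cdot> \<one>) T0" using exists_adic_subring assms by blast
  then obtain T where T: "maximal_adic_subring R ([p] \<cdot> \<one>) T"
    using adic_subring.exists_maximal_adic_subring[of R "[p] \<cdot> \<one>" T0] by blast
  interpret maximal_adic_subring R "[p] \<cdot> \<one>" T by fact
  show thesis using that[of T] subring inv_q F_D F_eq_carrier by blast
qed

lemma (in ring_hom_ring) hom_add_pow_one: "h ([(n::nat)] \<cdot>\<^bsub>R\<^esub> \<one>\<^bsub>R\<^esub>) = [n] \<cdot>\<^bsub>S\<^esub> \<one>\<^bsub>S\<^esub>"
  by (induction n) auto

text \<open>Pulling back a subring \<open>T\<close> of the field with \<open>S = T[1/p]\<close> gives a subring that together
  with \<open>u\<close> generates \<open>R\<close> without containing \<open>u\<close>; Zorn's lemma then yields a maximal subring.\<close>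

lemma submaximal_if_hom_to_field:
  assumes R: "cring R" and S: "field S" and h: "h \<in> ring_hom R S"
    and char: "\<And>n::nat. 0 < n \<Longrightarrow> [n] \<cdot>\<^bsub>S\<^esub> \<one>\<^bsub>S\<^esub> \<noteq> \<zero>\<^bsub>S\<^esub>"
    and p: "Factorial_Ring.prime (p :: nat)"
    and u: "u \<in> carrier R" "h u \<otimes>\<^bsub>S\<^esub> [p] \<cdot>\<^bsub>S\<^esub> \<one>\<^bsub>S\<^esub> = \<one>\<^bsub>S\<^esub>"
  shows "submaximal R"
proof -
  interpret R: cring R by fact
  interpret S: field S by fact
  interpret h: ring_hom_ring R S h using h by (simp add: ring_hom_ringI2 R.ring_axioms S.ring_axioms)
  define q where "q = [p] \<cdot>\<^bsub>R\<^esub> \<one>\<^bsub>R\<^esub>"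
  have qc: "q \<in> carrier R" unfolding q_def by simp
  have hq: "h q = [p] \<cdot>\<^bsub>S\<^esub> \<one>\<^bsub>S\<^esub>" unfolding q_def by (rule h.hom_add_pow_one)
  obtain T' where T': "subring T' S" "inv\<^bsub>S\<^esub> (h q) \<notin> T'"
    "\<And>x. x \<in> carrier S \<Longrightarrow> \<exists>n::nat. h q [^]\<^bsub>S\<^esub> n \<otimes>\<^bsub>S\<^esub> x \<in> T'"
    using S.exists_subring_inverting_prime[OF char p] hq by metis
  have hu: "h u \<in> carrier S" "h u \<otimes>\<^bsub>S\<^esub> h q = \<one>\<^bsub>S\<^esub>" using u hq by auto
  have inv_hq: "inv\<^bsub>S\<^esub> (h q) = h u"
    using S.comm_inv_char[of "h q" "h u"] hu S.m_comm qc by simp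
  define T where "T = {r \<in> carrier R. h r \<in> T'}"
  note T'E = subringE[OF T'(1)]
  have T: "subring T R"
    unfolding T_def by (rule R.subringI) (use T'E in auto)
  have uT: "u \<notin> T" using T' inv_hq unfolding T_def by simp
  let ?A = "{W. subring W R \<and> T \<subseteq> W \<and> u \<notin> W}"
  have "\<exists>W\<in>?A. \<forall>V\<in>?A. W \<subseteq> V \<longrightarrow> V = W"
  proof (rule subset_Zorn_nonempty)
    show "?A \<noteq> {}" using T uT by blast
  next
    fix C assume C: "C \<noteq> {}" "subset.chain ?A C"
    have "subring (\<Union>C) R" using R.chain_Union_subring[OF C] by simp
    moreover have sub: "C \<subseteq> ?A" using C(2) unfolding pred_on.chain_def by (rule conjunct1)
    moreover have "T \<subseteq> \<Union>C" using C(1) sub by fastforce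
    moreover have "u \<notin> \<Union>C" using sub by auto
    ultimately show "\<Union>C \<in> ?A" by simp
  qed
  then obtain W where "W \<in> ?A" and maxA: "\<forall>V\<in>?A. W \<subseteq> V \<longrightarrow> V = W" by (rule bexE)
  then have W: "subring W R" "T \<subseteq> W" "u \<notin> W" by simp_all
  have max: "V = W" if "subring V R" "T \<subseteq> V" "u \<notin> V" "W \<subseteq> V" for V
    using maxA that by simp
  have gen: "V = carrier R" if V: "subring V R" "T \<subseteq> V" "u \<in> V" for V
  proof
    show "V \<subseteq> carrier R" using subringE(1)[OF V(1)] .
    show "carrier R \<subseteq> V"
    proof
      fix r assume r: "r \<in> carrier R"
      then obtain n :: nat where n: "h q [^]\<^bsub>S\<^esub> n \<otimes>\<^bsub>S\<^esub> h r \<in> T'" using T'(3)[of "h r"] by auto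
      have pow: "u [^]\<^bsub>R\<^esub> n \<in> carrier R" "q [^]\<^bsub>R\<^esub> n \<in> carrier R" using u qc by auto
      have hpow: "h (q [^]\<^bsub>R\<^esub> n) = h q [^]\<^bsub>S\<^esub> n" "h (u [^]\<^bsub>R\<^esub> n) = h u [^]\<^bsub>S\<^esub> n"
        using qc u by (simp_all add: h.hom_nat_pow)
      \<comment> \<open>The element \<open>s = q [^] n r\<close> lies in \<open>T\<close> for
        suitable \<open>n\<close>, and \<open>s u [^] n\<close> has the same image as
        \<open>r\<close> because \<open>h u\<close> inverts \<open>h q\<close>. The difference
        \<open>k\<close> is in the kernel of \<open>h\<close>, hence in \<open>T\<close>. So
        \<open>r = k + s u [^] n\<close> lies in every ring containing \<open>T\<close> and
        \<open>u\<close>.\<close>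
      define s where "s = q [^]\<^bsub>R\<^esub> n \<otimes>\<^bsub>R\<^esub> r"
      define k where "k = r \<ominus>\<^bsub>R\<^esub> s \<otimes>\<^bsub>R\<^esub> u [^]\<^bsub>R\<^esub> n"
      have c: "s \<in> carrier R" "k \<in> carrier R" unfolding k_def s_def using r pow by auto
      have sT: "s \<in> T" using n c hpow r pow unfolding T_def s_def by simp
      have "h q [^]\<^bsub>S\<^esub> n \<otimes>\<^bsub>S\<^esub> h u [^]\<^bsub>S\<^esub> n = \<one>\<^bsub>S\<^esub>"
        using S.nat_pow_distrib[of "h q" "h u" n] hu qc S.m_comm by simp
      then have "h (s \<otimes>\<^bsub>R\<^esub> u [^]\<^bsub>R\<^esub> n) = h r"
        unfolding s_def using r pow qc hu hpow S.m_comm[of "h q [^]\<^bsub>S\<^esub> n" "h r"]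
        by (simp add: S.m_assoc)
      moreover have suc: "s \<otimes>\<^bsub>R\<^esub> u [^]\<^bsub>R\<^esub> n \<in> carrier R" using c pow by simp
      ultimately have "h k = \<zero>\<^bsub>S\<^esub>"
        unfolding k_def a_minus_def using r by (simp add: S.r_neg)
      then have kT: "k \<in> T" using c T'E(2) unfolding T_def by simp
      have "r = k \<oplus>\<^bsub>R\<^esub> s \<otimes>\<^bsub>R\<^esub> u [^]\<^bsub>R\<^esub> n"
        unfolding k_def a_minus_def using r suc by (simp add: R.a_assoc R.l_neg)
      moreover have "u [^]\<^bsub>R\<^esub> n \<in> V" using R.subring_nat_pow[OF V(1,3)] .
      ultimately show "r \<in> V"
        using subringE(7)[OF V(1) subsetD[OF V(2) kT] subringE(6)[OF V(1) subsetD[OF V(2) sT]]] by simp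
    qed
  qed
  have "maximal_subring W R"
    unfolding maximal_subring_def
  proof (intro conjI W notI)
    show "W \<subset> carrier R" using subringE(1)[OF W(1)] W(3) u by blast
    assume "\<exists>V. subring V R \<and> W \<subset> V \<and> V \<subset> carrier R"
    then obtain V where V: "subring V R" "W \<subset> V" "V \<subset> carrier R" by blast
    then have "u \<in> V" using max[of V] W(2) by blast
    then show False using gen[of V] V W(2) by blast
  qed
  then show ?thesis unfolding submaximal_def by blast
qed

section \<open>Fields of fractions and prime ideals\<close>

context domain
begin

text \<open>The class of the pair \<open>(a, b)\<close> under cross multiplication, kept as a set of
  pairs so that equal fractions are equal sets.\<close>

definition fraction :: "'a \<Rightarrow> 'a \<Rightarrow> ('a \<times> 'a) set" where
  "fraction a b = {(c, d). c \<in> carrier R \<and> d \<in> carrier R - {\<zero>} \<and> a \<otimes> d = c \<otimes> b}"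

text \<open>An arbitrary representative of the class; \<open>fraction_ops\<close> shows that the
  field operations do not depend on the choice.\<close>

definition numerator where "numerator x = fst (SOME z. z \<in> x)"

definition denominator where "denominator x = snd (SOME z. z \<in> x)"

definition fraction_field :: "('a \<times> 'a) set ring" where
  "fraction_field =
    \<lparr>carrier = {fraction a b | a b. a \<in> carrier R \<and> b \<in> carrier R - {\<zero>}},
     monoid.mult = (\<lambda>x y. fraction (numerator x \<otimes> numerator y) (denominator x \<otimes> denominator y)),
     one = fraction \<one> \<one>, ring.zero = fraction \<zero> \<one>,
     add = (\<lambda>x y. fraction (numerator x \<otimes> denominator y \<oplus> numerator y \<otimes> denominator x)
       (denominator x \<otimes> denominator y))\<rparr>"

lemma fraction_eq_iff:
  assumes "a \<in> carrier R" "b \<in> carrier R - {\<zero>}" "c \<in> carrier R" "d \<in> carrier R - {\<zero>}"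
  shows "fraction a b = fraction c d \<longleftrightarrow> a \<otimes> d = c \<otimes> b"
proof
  assume "fraction a b = fraction c d"
  moreover have "(a, b) \<in> fraction a b" using assms unfolding fraction_def by simp
  ultimately have "(a, b) \<in> fraction c d" by simp
  then show "a \<otimes> d = c \<otimes> b" unfolding fraction_def by simp
next
  have sub: "fraction a b \<subseteq> fraction c d"
    if eq: "a \<otimes> d = c \<otimes> b" and ab: "a \<in> carrier R" "b \<in> carrier R - {\<zero>}"
      and cd: "c \<in> carrier R" "d \<in> carrier R - {\<zero>}" for a b c d
  proof (clarify)
    fix e f assume "(e, f) \<in> fraction a b"
    then have ef: "e \<in> carrier R" "f \<in> carrier R - {\<zero>}" "a \<otimes> f = e \<otimes> b"
      unfolding fraction_def by simp_all
    have car: "b \<in> carrier R" "d \<in> carrier R" "f \<in> carrier R" "b \<noteq> \<zero>"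
      using ab cd ef by auto
    \<comment> \<open>Transitivity of cross multiplication holds only after multiplying by
      \<open>b\<close>, which can be cancelled in a domain.\<close>
    have "b \<otimes> (c \<otimes> f) = (c \<otimes> b) \<otimes> f" using car cd ef by algebra
    also have "\<dots> = (a \<otimes> f) \<otimes> d" unfolding eq[symmetric] using car ab by algebra
    also have "\<dots> = b \<otimes> (e \<otimes> d)" unfolding ef(3) using car ef(1) by algebra
    finally have "c \<otimes> f = e \<otimes> d" using m_lcancel[of b "c \<otimes> f" "e \<otimes> d"] car cd(1) ef(1) by simp
    then show "(e, f) \<in> fraction c d" using ef unfolding fraction_def by simp
  qed
  assume eq: "a \<otimes> d = c \<otimes> b"
  show "fraction a b = fraction c d" using sub[OF eq] sub[OF eq[symmetric]] assms by blast
qed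

lemma fraction_rep:
  assumes "a \<in> carrier R" "b \<in> carrier R - {\<zero>}"
  shows "numerator (fraction a b) \<in> carrier R" "denominator (fraction a b) \<in> carrier R"
    "denominator (fraction a b) \<noteq> \<zero>"
    "a \<otimes> denominator (fraction a b) = numerator (fraction a b) \<otimes> b"
proof -
  have "(a, b) \<in> fraction a b" using assms unfolding fraction_def by simp
  then have "(SOME z. z \<in> fraction a b) \<in> fraction a b" by (rule someI)
  then have "(numerator (fraction a b), denominator (fraction a b)) \<in> fraction a b"
    unfolding numerator_def denominator_def by simp
  then show "numerator (fraction a b) \<in> carrier R" "denominator (fraction a b) \<in> carrier R"
    "denominator (fraction a b) \<noteq> \<zero>"
    "a \<otimes> denominator (fraction a b) = numerator (fraction a b) \<otimes> b"
    by (simp_all add: fraction_def)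
qed

lemma fraction_ops:
  assumes a: "a \<in> carrier R" and b: "b \<in> carrier R - {\<zero>}"
    and c: "c \<in> carrier R" and d: "d \<in> carrier R - {\<zero>}"
  shows fraction_mult: "fraction a b \<otimes>\<^bsub>fraction_field\<^esub> fraction c d = fraction (a \<otimes> c) (b \<otimes> d)"
    and fraction_add:
      "fraction a b \<oplus>\<^bsub>fraction_field\<^esub> fraction c d = fraction (a \<otimes> d \<oplus> c \<otimes> b) (b \<otimes> d)"
proof -
  obtain a' b' where ab': "numerator (fraction a b) = a'" "denominator (fraction a b) = b'" by blast
  obtain c' d' where cd': "numerator (fraction c d) = c'" "denominator (fraction c d) = d'" by blast
  note r1 = fraction_rep[OF a b, unfolded ab'] and r2 = fraction_rep[OF c d, unfolded cd']
  have bc: "b \<in> carrier R" "b \<noteq> \<zero>" "d \<in> carrier R" "d \<noteq> \<zero>" using b d by auto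
  have nz: "b \<otimes> d \<in> carrier R - {\<zero>}" "b' \<otimes> d' \<in> carrier R - {\<zero>}"
    using bc r1 r2 by (auto simp: integral_iff)
  have "(a' \<otimes> c') \<otimes> (b \<otimes> d) = (a' \<otimes> b) \<otimes> (c' \<otimes> d)"
    using a c bc(1,3) r1(1,2) r2(1,2) by algebra
  also have "\<dots> = (a \<otimes> c) \<otimes> (b' \<otimes> d')"
    unfolding r1(4)[symmetric] r2(4)[symmetric] using a c bc(1,3) r1(1,2) r2(1,2) by algebra
  finally have "fraction (a' \<otimes> c') (b' \<otimes> d') = fraction (a \<otimes> c) (b \<otimes> d)"
    using nz a c r1 r2 by (subst fraction_eq_iff) auto
  then show "fraction a b \<otimes>\<^bsub>fraction_field\<^esub> fraction c d = fraction (a \<otimes> c) (b \<otimes> d)"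
    by (simp add: fraction_field_def ab' cd')
  have "(a' \<otimes> d' \<oplus> c' \<otimes> b') \<otimes> (b \<otimes> d) = (a' \<otimes> b) \<otimes> (d' \<otimes> d) \<oplus> (c' \<otimes> d) \<otimes> (b' \<otimes> b)"
    using a c bc(1,3) r1(1,2) r2(1,2) by algebra
  also have "\<dots> = (a \<otimes> d \<oplus> c \<otimes> b) \<otimes> (b' \<otimes> d')"
    unfolding r1(4)[symmetric] r2(4)[symmetric] using a c bc(1,3) r1(1,2) r2(1,2) by algebra
  finally have "fraction (a' \<otimes> d' \<oplus> c' \<otimes> b') (b' \<otimes> d') = fraction (a \<otimes> d \<oplus> c \<otimes> b) (b \<otimes> d)"
    using nz a c r1 r2 bc by (subst fraction_eq_iff) auto
  then show "fraction a b \<oplus>\<^bsub>fraction_field\<^esub> fraction c d = fraction (a \<otimes> d \<oplus> c \<otimes> b) (b \<otimes> d)"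
    by (simp add: fraction_field_def ab' cd')
qed

lemma fraction_closed:
  "a \<in> carrier R \<Longrightarrow> b \<in> carrier R - {\<zero>} \<Longrightarrow> fraction a b \<in> carrier fraction_field"
  unfolding fraction_field_def by auto

lemma fraction_field_cases:
  assumes "x \<in> carrier fraction_field"
  obtains a b where "x = fraction a b" "a \<in> carrier R" "b \<in> carrier R" "b \<noteq> \<zero>"
  using assms unfolding fraction_field_def by auto

lemma fraction_field_zero: "\<zero>\<^bsub>fraction_field\<^esub> = fraction \<zero> \<one>"
  and fraction_field_one: "\<one>\<^bsub>fraction_field\<^esub> = fraction \<one> \<one>"
  by (simp_all add: fraction_field_def)

lemmas fraction_field_simps = fraction_mult fraction_add fraction_closed
  fraction_field_zero fraction_field_one integral_iff

lemma fraction_eqI: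
  assumes "a \<otimes> d = c \<otimes> b" "a \<in> carrier R" "c \<in> carrier R"
    "b \<in> carrier R" "b \<noteq> \<zero>" "d \<in> carrier R" "d \<noteq> \<zero>"
  shows "fraction a b = fraction c d"
  using assms fraction_eq_iff by simp

lemma fraction_field_cring: "cring fraction_field"
proof (rule cringI)
  show "abelian_group fraction_field"
  proof (rule abelian_groupI)
    fix x y assume "x \<in> carrier fraction_field" "y \<in> carrier fraction_field"
    then show "x \<oplus>\<^bsub>fraction_field\<^esub> y \<in> carrier fraction_field"
      by (elim fraction_field_cases) (simp add: fraction_field_simps)
  next
    show "\<zero>\<^bsub>fraction_field\<^esub> \<in> carrier fraction_field" by (simp add: fraction_field_simps)
  next
    fix x y z assume "x \<in> carrier fraction_field" "y \<in> carrier fraction_field" "z \<in> carrier fraction_field"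
    then show "x \<oplus>\<^bsub>fraction_field\<^esub> y \<oplus>\<^bsub>fraction_field\<^esub> z = x \<oplus>\<^bsub>fraction_field\<^esub> (y \<oplus>\<^bsub>fraction_field\<^esub> z)"
    proof (elim fraction_field_cases)
      fix a b a' b' a'' b'' assume eq: "x = fraction a b" "y = fraction a' b'" "z = fraction a'' b''"
        and c: "a \<in> carrier R" "b \<in> carrier R" "a' \<in> carrier R" "b' \<in> carrier R"
          "a'' \<in> carrier R" "b'' \<in> carrier R"
        and nz: "b \<noteq> \<zero>" "b' \<noteq> \<zero>" "b'' \<noteq> \<zero>"
      have "((a \<otimes> b' \<oplus> a' \<otimes> b) \<otimes> b'' \<oplus> a'' \<otimes> (b \<otimes> b')) \<otimes> (b \<otimes> (b' \<otimes> b''))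
        = (a \<otimes> (b' \<otimes> b'') \<oplus> (a' \<otimes> b'' \<oplus> a'' \<otimes> b') \<otimes> b) \<otimes> (b \<otimes> b' \<otimes> b'')"
        using c by algebra
      then show ?thesis
        unfolding eq using c nz by (simp add: fraction_field_simps) (rule fraction_eqI; simp add: integral_iff)
    qed
  next
    fix x y assume "x \<in> carrier fraction_field" "y \<in> carrier fraction_field"
    then show "x \<oplus>\<^bsub>fraction_field\<^esub> y = y \<oplus>\<^bsub>fraction_field\<^esub> x"
      by (elim fraction_field_cases) (simp add: fraction_field_simps a_comm m_comm)
  next
    fix x assume "x \<in> carrier fraction_field"
    then show "\<zero>\<^bsub>fraction_field\<^esub> \<oplus>\<^bsub>fraction_field\<^esub> x = x"
      by (elim fraction_field_cases) (simp add: fraction_field_simps)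
  next
    fix x assume "x \<in> carrier fraction_field"
    then show "\<exists>y\<in>carrier fraction_field. y \<oplus>\<^bsub>fraction_field\<^esub> x = \<zero>\<^bsub>fraction_field\<^esub>"
    proof (elim fraction_field_cases)
      fix a b assume x: "x = fraction a b" "a \<in> carrier R" "b \<in> carrier R" "b \<noteq> \<zero>"
      have "(\<ominus> a) \<otimes> b \<oplus> a \<otimes> b = \<zero>" using x by (simp add: l_minus l_neg)
      then have "fraction (\<ominus> a) b \<oplus>\<^bsub>fraction_field\<^esub> x = \<zero>\<^bsub>fraction_field\<^esub>"
        using x by (simp add: fraction_field_simps) (rule fraction_eqI; simp add: integral_iff)
      then show ?thesis using fraction_closed[of "\<ominus> a" b] x by (intro bexI) simp_all
    qed
  qed
  show "comm_monoid fraction_field"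
  proof (rule comm_monoidI)
    fix x y assume "x \<in> carrier fraction_field" "y \<in> carrier fraction_field"
    then show "x \<otimes>\<^bsub>fraction_field\<^esub> y \<in> carrier fraction_field"
      by (elim fraction_field_cases) (simp add: fraction_field_simps)
  next
    show "\<one>\<^bsub>fraction_field\<^esub> \<in> carrier fraction_field" by (simp add: fraction_field_simps)
  next
    fix x y z assume "x \<in> carrier fraction_field" "y \<in> carrier fraction_field" "z \<in> carrier fraction_field"
    then show "x \<otimes>\<^bsub>fraction_field\<^esub> y \<otimes>\<^bsub>fraction_field\<^esub> z = x \<otimes>\<^bsub>fraction_field\<^esub> (y \<otimes>\<^bsub>fraction_field\<^esub> z)"
      by (elim fraction_field_cases) (simp add: fraction_field_simps m_assoc)
  next
    fix x assume "x \<in> carrier fraction_field"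
    then show "\<one>\<^bsub>fraction_field\<^esub> \<otimes>\<^bsub>fraction_field\<^esub> x = x"
      by (elim fraction_field_cases) (simp add: fraction_field_simps)
  next
    fix x y assume "x \<in> carrier fraction_field" "y \<in> carrier fraction_field"
    then show "x \<otimes>\<^bsub>fraction_field\<^esub> y = y \<otimes>\<^bsub>fraction_field\<^esub> x"
      by (elim fraction_field_cases) (simp add: fraction_field_simps m_comm)
  qed
  fix x y z assume "x \<in> carrier fraction_field" "y \<in> carrier fraction_field" "z \<in> carrier fraction_field"
  then show "(x \<oplus>\<^bsub>fraction_field\<^esub> y) \<otimes>\<^bsub>fraction_field\<^esub> z
    = x \<otimes>\<^bsub>fraction_field\<^esub> z \<oplus>\<^bsub>fraction_field\<^esub> y \<otimes>\<^bsub>fraction_field\<^esub> z"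
  proof (elim fraction_field_cases)
    fix a b a' b' a'' b'' assume eq: "x = fraction a b" "y = fraction a' b'" "z = fraction a'' b''"
      and c: "a \<in> carrier R" "b \<in> carrier R" "a' \<in> carrier R" "b' \<in> carrier R"
        "a'' \<in> carrier R" "b'' \<in> carrier R"
      and nz: "b \<noteq> \<zero>" "b' \<noteq> \<zero>" "b'' \<noteq> \<zero>"
    have "((a \<otimes> b' \<oplus> a' \<otimes> b) \<otimes> a'') \<otimes> ((b \<otimes> b'') \<otimes> (b' \<otimes> b''))
      = ((a \<otimes> a'') \<otimes> (b' \<otimes> b'') \<oplus> (a' \<otimes> a'') \<otimes> (b \<otimes> b'')) \<otimes> ((b \<otimes> b') \<otimes> b'')"
      using c by algebra
    then show ?thesis
      unfolding eq using c nz by (simp add: fraction_field_simps) (rule fraction_eqI; simp add: integral_iff)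
  qed
qed

lemma fraction_field_field: "field fraction_field"
proof (rule cring.cring_fieldI2[OF fraction_field_cring])
  show "\<zero>\<^bsub>fraction_field\<^esub> \<noteq> \<one>\<^bsub>fraction_field\<^esub>"
    by (simp add: fraction_field_simps fraction_eq_iff)
  fix x assume x: "x \<in> carrier fraction_field" "x \<noteq> \<zero>\<^bsub>fraction_field\<^esub>"
  then obtain a b where ab: "x = fraction a b" "a \<in> carrier R" "b \<in> carrier R" "b \<noteq> \<zero>"
    by (elim fraction_field_cases)
  then have "a \<noteq> \<zero>" using x by (auto simp: fraction_field_simps fraction_eq_iff)
  then have "x \<otimes>\<^bsub>fraction_field\<^esub> fraction b a = \<one>\<^bsub>fraction_field\<^esub>"
    using ab by (simp add: fraction_field_simps fraction_eq_iff m_comm)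
  then show "\<exists>y\<in>carrier fraction_field. x \<otimes>\<^bsub>fraction_field\<^esub> y = \<one>\<^bsub>fraction_field\<^esub>"
    using fraction_closed[of b a] ab \<open>a \<noteq> \<zero>\<close> by (intro bexI) simp_all
qed

lemma fraction_hom: "(\<lambda>a. fraction a \<one>) \<in> ring_hom R fraction_field"
  by (rule ring_hom_memI) (simp_all add: fraction_field_simps)

lemma fraction_eq_zero_iff:
  "a \<in> carrier R \<Longrightarrow> fraction a \<one> = \<zero>\<^bsub>fraction_field\<^esub> \<longleftrightarrow> a = \<zero>"
  by (simp add: fraction_field_simps fraction_eq_iff)

end

text \<open>One Zorn argument for two purposes: \<open>S = {\<one>}\<close> yields maximal ideals, a
  multiplicative \<open>S\<close> yields prime ideals.\<close>

lemma (in cring) exists_ideal_maximal_disjoint: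
  assumes I: "ideal I R" "I \<inter> S = {}"
  shows "\<exists>P. ideal P R \<and> I \<subseteq> P \<and> P \<inter> S = {} \<and>
    (\<forall>J. ideal J R \<longrightarrow> P \<subseteq> J \<longrightarrow> J \<inter> S = {} \<longrightarrow> J = P)"
proof -
  let ?A = "{J. ideal J R \<and> I \<subseteq> J \<and> J \<inter> S = {}}"
  have "\<exists>P\<in>?A. \<forall>J\<in>?A. P \<subseteq> J \<longrightarrow> J = P"
  proof (rule subset_Zorn_nonempty)
    show "?A \<noteq> {}" using I by blast
  next
    fix C assume C: "C \<noteq> {}" "subset.chain ?A C"
    then have sub: "C \<subseteq> ?A" unfolding pred_on.chain_def by simp
    have "subset.chain {I. ideal I R} C"
      using C(2) unfolding pred_on.chain_def by auto
    then have "ideal (\<Union>C) R" using chain_Union_is_ideal[of C] C(1) by simp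
    moreover have "I \<subseteq> \<Union>C" using C(1) sub by fastforce
    moreover have "\<Union>C \<inter> S = {}" using sub by auto
    ultimately show "\<Union>C \<in> ?A" by simp
  qed
  then obtain P where "P \<in> ?A" and max: "\<forall>J\<in>?A. P \<subseteq> J \<longrightarrow> J = P" by (rule bexE)
  then have P: "ideal P R" "I \<subseteq> P" "P \<inter> S = {}" by simp_all
  moreover have "J = P" if "ideal J R" "P \<subseteq> J" "J \<inter> S = {}" for J
    using max P(2) that by simp
  ultimately show ?thesis by (intro exI[of _ P] conjI allI impI)
qed

text \<open>A nonunit generates a proper ideal, and the proper ideals are exactly those disjoint
  from \<open>{\<one>}\<close>.\<close>

lemma (in cring) exists_maximalideal_mem:
  assumes x: "x \<in> carrier R" and nonunit: "\<And>u. u \<in> carrier R \<Longrightarrow> u \<otimes> x \<noteq> \<one>"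
  obtains M where "maximalideal M R" "x \<in> M"
proof -
  have "\<one> \<notin> PIdl x" using nonunit unfolding cgenideal_def by fastforce
  then have "PIdl x \<inter> {\<one>} = {}" by simp
  then obtain M where M: "ideal M R" "PIdl x \<subseteq> M" "M \<inter> {\<one>} = {}"
    "\<forall>J. ideal J R \<longrightarrow> M \<subseteq> J \<longrightarrow> J \<inter> {\<one>} = {} \<longrightarrow> J = M"
    using exists_ideal_maximal_disjoint[OF cgenideal_ideal[OF x], of "{\<one>}"] by metis
  have "maximalideal M R"
  proof (rule maximalidealI[OF M(1)])
    show "carrier R \<noteq> M" using M(3) by auto
    fix J assume J: "ideal J R" "M \<subseteq> J"
    then show "J = M \<or> J = carrier R"
      using M(4) J ideal.one_imp_carrier[OF J(1)] by auto
  qed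
  then show thesis using that M(2) cgenideal_self[OF x] by blast
qed

text \<open>Let \<open>P\<close> be maximal among ideals disjoint from \<open>S\<close>. If
  \<open>a\<close> and \<open>b\<close> are outside \<open>P\<close>, then \<open>P + (a)\<close>
  and \<open>P + (b)\<close> meet \<open>S\<close> in some \<open>s\<close> and \<open>t\<close>. If
  moreover \<open>a b\<close> were in \<open>P\<close>, the product \<open>s t\<close> would lie
  both in \<open>P\<close> and in \<open>S\<close>.\<close>

lemma (in cring) exists_primeideal_disjoint:
  assumes S: "S \<subseteq> carrier R" "\<one> \<in> S" "\<zero> \<notin> S" "\<And>s t. s \<in> S \<Longrightarrow> t \<in> S \<Longrightarrow> s \<otimes> t \<in> S"
  shows "\<exists>P. primeideal P R \<and> P \<inter> S = {}"
proof -
  have "{\<zero>} \<inter> S = {}" using S(3) by simp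
  then obtain P where P: "ideal P R" "{\<zero>} \<subseteq> P" "P \<inter> S = {}"
    "\<forall>J. ideal J R \<longrightarrow> P \<subseteq> J \<longrightarrow> J \<inter> S = {} \<longrightarrow> J = P"
    using exists_ideal_maximal_disjoint[OF zeroideal, of S] by metis
  interpret P: ideal P R by fact
  have meets: "\<exists>s\<in>S. \<exists>x\<in>P. \<exists>r\<in>carrier R. s = x \<oplus> r \<otimes> a" if a: "a \<in> carrier R" "a \<notin> P" for a
  proof -
    let ?J = "P <+>\<^bsub>R\<^esub> PIdl a"
    have J: "ideal ?J R" using add_ideals[OF P(1) cgenideal_ideal[OF a(1)]] .
    have PJ: "P \<subseteq> ?J"
    proof
      fix x assume x: "x \<in> P"
      then have "x = x \<oplus> \<zero> \<otimes> a" using a(1) P.Icarr by simp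
      then show "x \<in> ?J" using x unfolding set_add_def' cgenideal_def by blast
    qed
    have "a = \<zero> \<oplus> \<one> \<otimes> a" using a(1) by simp
    then have "a \<in> ?J" unfolding set_add_def' cgenideal_def using P.zero_closed by blast
    then have "?J \<inter> S \<noteq> {}" using P(4) J PJ a(2) by metis
    then show ?thesis unfolding set_add_def' cgenideal_def by blast
  qed
  have "primeideal P R"
  proof (rule primeidealI[OF P(1) is_cring])
    show "carrier R \<noteq> P" using P(3) S(2) by auto
    fix a b assume ab: "a \<in> carrier R" "b \<in> carrier R" "a \<otimes> b \<in> P"
    show "a \<in> P \<or> b \<in> P"
    proof (rule ccontr)
      assume "\<not> (a \<in> P \<or> b \<in> P)"
      then obtain s x r t y v where s: "s \<in> S" "x \<in> P" "r \<in> carrier R" "s = x \<oplus> r \<otimes> a"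
        and t: "t \<in> S" "y \<in> P" "v \<in> carrier R" "t = y \<oplus> v \<otimes> b"
        using meets[OF ab(1)] meets[OF ab(2)] by blast
      have c: "x \<in> carrier R" "y \<in> carrier R" using s t P.Icarr by auto
      have "s \<otimes> t = (y \<oplus> v \<otimes> b) \<otimes> x \<oplus> ((r \<otimes> a) \<otimes> y \<oplus> (r \<otimes> v) \<otimes> (a \<otimes> b))"
        unfolding s(4) t(4) using c s(3) t(3) ab(1,2) by algebra
      moreover have "\<dots> \<in> P"
        using s(3) t(3,4) subsetD[OF S(1) t(1)] ab(1)
        by (intro P.a_closed P.I_l_closed[OF s(2)] P.I_l_closed[OF t(2)] P.I_l_closed[OF ab(3)]) simp_all
      ultimately show False using S(4)[OF s(1) t(1)] P(3) by auto
    qed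
  qed
  then show ?thesis using P(3) by blast
qed

lemma (in ideal) rcos_eq_zero_iff:
  assumes "x \<in> carrier R"
  shows "I +> x = \<zero>\<^bsub>R Quot I\<^esub> \<longleftrightarrow> x \<in> I"
proof
  assume "I +> x = \<zero>\<^bsub>R Quot I\<^esub>"
  then show "x \<in> I" using assms rcos_const_imp_mem by (simp add: FactRing_def)
next
  assume "x \<in> I"
  then show "I +> x = \<zero>\<^bsub>R Quot I\<^esub>" using a_rcos_zero[OF is_ideal] by (simp add: FactRing_def)
qed

text \<open>The positive integer multiples of \<open>\<one>\<close> form a multiplicative set
  without zero. A prime ideal \<open>P\<close> avoiding it gives a domain \<open>R Quot P\<close>
  whose fraction field has characteristic zero, and the image of \<open>u\<close> there is
  \<open>1/p\<close>.\<close>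

lemma (in cring) submaximal_if_prime_unit:
  assumes char: "\<And>n::nat. 0 < n \<Longrightarrow> [n] \<cdot> \<one> \<noteq> \<zero>"
    and p: "Factorial_Ring.prime (p :: nat)"
    and u: "u \<in> carrier R" "u \<otimes> [p] \<cdot> \<one> = \<one>"
  shows "submaximal R"
proof -
  let ?S = "{[n] \<cdot> \<one> | n::nat. 0 < n}"
  have mult: "s \<otimes> t \<in> ?S" if st: "s \<in> ?S" "t \<in> ?S" for s t
  proof -
    from st obtain n m :: nat where "s = [n] \<cdot> \<one>" "t = [m] \<cdot> \<one>" "0 < n" "0 < m" by blast
    then have "s \<otimes> t = [(n * m)] \<cdot> \<one>" "0 < n * m" by (simp_all add: nat_embed_mult)
    then show ?thesis by blast
  qed
  have "[(1::nat)] \<cdot> \<one> = \<one>" by simp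
  then have one: "\<one> \<in> ?S" by (intro CollectI exI[of _ "1::nat"]) simp
  have zero: "\<zero> \<notin> ?S"
  proof
    assume "\<zero> \<in> ?S"
    then obtain n :: nat where "\<zero> = [n] \<cdot> \<one>" "0 < n" by blast
    then show False using char[of n] by simp
  qed
  have "?S \<subseteq> carrier R" by auto
  then obtain P where P: "primeideal P R" "P \<inter> ?S = {}"
    using exists_primeideal_disjoint[OF _ one zero mult] by blast
  interpret P: primeideal P R by fact
  interpret D: domain "R Quot P" by (rule P.quotient_is_domain)
  let ?h = "\<lambda>x. D.fraction (P +> x) \<one>\<^bsub>R Quot P\<^esub>"
  interpret E: field D.fraction_field by (rule D.fraction_field_field)
  have h: "?h \<in> ring_hom R D.fraction_field"
    using ring_hom_trans[OF P.rcos_ring_hom D.fraction_hom] by (simp add: comp_def)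
  interpret h: ring_hom_ring R D.fraction_field ?h
    using h by (simp add: ring_hom_ringI2 ring_axioms E.ring_axioms)
  have "[n] \<cdot>\<^bsub>D.fraction_field\<^esub> \<one>\<^bsub>D.fraction_field\<^esub> \<noteq> \<zero>\<^bsub>D.fraction_field\<^esub>" if n: "0 < n" for n :: nat
  proof -
    have "[n] \<cdot> \<one> \<notin> P" using P(2) n by blast
    then have "P +> [n] \<cdot> \<one> \<noteq> \<zero>\<^bsub>R Quot P\<^esub>" using P.rcos_eq_zero_iff by simp
    then have "?h ([n] \<cdot> \<one>) \<noteq> \<zero>\<^bsub>D.fraction_field\<^esub>"
      using D.fraction_eq_zero_iff ring_hom_closed[OF P.rcos_ring_hom] by simp
    then show ?thesis using h.hom_add_pow_one[of n] by simp
  qed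
  moreover have "?h (u \<otimes> [p] \<cdot> \<one>) = ?h u \<otimes>\<^bsub>D.fraction_field\<^esub> ?h ([p] \<cdot> \<one>)"
    using u(1) by (intro h.hom_mult) simp_all
  then have "?h u \<otimes>\<^bsub>D.fraction_field\<^esub> [p] \<cdot>\<^bsub>D.fraction_field\<^esub> \<one>\<^bsub>D.fraction_field\<^esub>
    = \<one>\<^bsub>D.fraction_field\<^esub>"
    unfolding u(2) h.hom_add_pow_one h.hom_one by (rule sym)
  ultimately show ?thesis
    by (rule submaximal_if_hom_to_field[OF is_cring E.field_axioms h _ p u(1)])
qed

section \<open>Characteristics of residue fields\<close>

lemma ring_char_zeroD:
  fixes n :: nat
  assumes "ring_char R = 0" "0 < n"
  shows "[n] \<cdot>\<^bsub>R\<^esub> \<one>\<^bsub>R\<^esub> \<noteq> \<zero>\<^bsub>R\<^esub>"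
proof
  let ?P = "\<lambda>n::nat. 0 < n \<and> [n] \<cdot>\<^bsub>R\<^esub> \<one>\<^bsub>R\<^esub> = \<zero>\<^bsub>R\<^esub>"
  assume "[n] \<cdot>\<^bsub>R\<^esub> \<one>\<^bsub>R\<^esub> = \<zero>\<^bsub>R\<^esub>"
  then have n: "?P n" using assms by simp
  then have "\<exists>n. ?P n" by blast
  then have "ring_char R = (LEAST n. ?P n)" unfolding ring_char_def by (rule if_P)
  then show False using LeastI[of ?P n] n assms(1) by simp
qed

lemma ring_char_nonzeroD:
  assumes "ring_char R \<noteq> 0"
  shows "[ring_char R] \<cdot>\<^bsub>R\<^esub> \<one>\<^bsub>R\<^esub> = \<zero>\<^bsub>R\<^esub>"
    and "0 < m \<Longrightarrow> [m] \<cdot>\<^bsub>R\<^esub> \<one>\<^bsub>R\<^esub> = \<zero>\<^bsub>R\<^esub> \<Longrightarrow> ring_char R \<le> m"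
proof -
  let ?P = "\<lambda>n::nat. 0 < n \<and> [n] \<cdot>\<^bsub>R\<^esub> \<one>\<^bsub>R\<^esub> = \<zero>\<^bsub>R\<^esub>"
  have ex: "\<exists>n. ?P n" using assms unfolding ring_char_def by presburger
  then have eq: "ring_char R = (LEAST n. ?P n)" unfolding ring_char_def by (rule if_P)
  show "[ring_char R] \<cdot>\<^bsub>R\<^esub> \<one>\<^bsub>R\<^esub> = \<zero>\<^bsub>R\<^esub>" unfolding eq using LeastI_ex[OF ex] by simp
  show "0 < m \<Longrightarrow> [m] \<cdot>\<^bsub>R\<^esub> \<one>\<^bsub>R\<^esub> = \<zero>\<^bsub>R\<^esub> \<Longrightarrow> ring_char R \<le> m"
    unfolding eq by (rule Least_le) simp
qed

lemma (in domain) prime_ring_char: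
  assumes "ring_char R \<noteq> 0"
  shows "Factorial_Ring.prime (ring_char R)"
proof -
  define n where "n = ring_char R"
  have n: "n \<noteq> 0" "[n] \<cdot> \<one> = \<zero>" and min: "\<And>m. 0 < m \<Longrightarrow> [m] \<cdot> \<one> = \<zero> \<Longrightarrow> n \<le> m"
    using assms ring_char_nonzeroD[of R] unfolding n_def by blast+
  have "n \<noteq> 1" using n(2) by auto
  moreover have "m = 1 \<or> m = n" if "m dvd n" for m
  proof -
    from that obtain k where k: "n = m * k" by blast
    then have pos: "0 < m" "0 < k" using n(1) by auto
    have "[m] \<cdot> \<one> \<otimes> [k] \<cdot> \<one> = \<zero>" using n(2) unfolding k nat_embed_mult .
    then have "[m] \<cdot> \<one> = \<zero> \<or> [k] \<cdot> \<one> = \<zero>" using integral by simp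
    then have "n \<le> m \<or> n \<le> k" using min pos by blast
    then show ?thesis using k pos by (auto simp: le_antisym)
  qed
  ultimately have "Factorial_Ring.prime n" using n(1) by (simp add: prime_nat_iff)
  then show ?thesis by (simp add: n_def)
qed

text \<open>The remainder of \<open>p\<close> modulo the characteristic also annihilates
  \<open>\<one>\<close>, so minimality makes it zero; the characteristic then divides
  \<open>p\<close> and is not 1.\<close>

lemma (in domain) ring_char_eq_prime:
  assumes p: "Factorial_Ring.prime p" and zero: "[p] \<cdot> \<one> = \<zero>"
  shows "ring_char R = p"
proof -
  define r where "r = ring_char R"
  have p0: "0 < p" using p by (rule prime_gt_0_nat)
  then have r0: "r \<noteq> 0" using ring_char_zeroD[of R p] zero unfolding r_def by blast
  have r: "[r] \<cdot> \<one> = \<zero>" and min: "\<And>m. 0 < m \<Longrightarrow> [m] \<cdot> \<one> = \<zero> \<Longrightarrow> r \<le> m"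
    using ring_char_nonzeroD[of R] r0 unfolding r_def by blast+
  have "[p] \<cdot> \<one> = [(p div r * r + p mod r)] \<cdot> \<one>" by simp
  also have "\<dots> = [(p div r * r)] \<cdot> \<one> \<oplus> [(p mod r)] \<cdot> \<one>"
    by (rule add.nat_pow_mult[symmetric]) simp
  also have "\<dots> = [(p mod r)] \<cdot> \<one>" unfolding nat_embed_mult r by simp
  finally have "[(p mod r)] \<cdot> \<one> = \<zero>" using zero by simp
  then have "p mod r = 0" using min[of "p mod r"] r0 mod_less_divisor[of r p] by linarith
  then have "r dvd p" by blast
  moreover have "r \<noteq> 1" using r by auto
  ultimately show ?thesis using p unfolding r_def[symmetric] by (auto simp: prime_nat_iff)
qed

theorem corollary1p8:
  fixes R :: "('a, 'b) ring_scheme"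
  assumes "nonzero_cring R"
    and "ring_char R = 0"
    and "\<not> submaximal R"
  shows "{ring_char (R Quot M) | M. M \<in> max_ideals R} = {p :: nat. Factorial_Ring.prime p}
    \<and> infinite (max_ideals R)"
proof -
  interpret cring R using assms(1) by (rule nonzero_cring.axioms)
  have char: "[n] \<cdot>\<^bsub>R\<^esub> \<one>\<^bsub>R\<^esub> \<noteq> \<zero>\<^bsub>R\<^esub>" if "0 < n" for n :: nat
    using ring_char_zeroD assms(2) that by blast
  have "Factorial_Ring.prime (ring_char (R Quot M))" if "maximalideal M R" for M
  proof -
    interpret M: maximalideal M R by fact
    interpret K: field "R Quot M" by (rule M.quotient_is_field[OF is_cring])
    have "ring_char (R Quot M) \<noteq> 0"
    proof
      assume "ring_char (R Quot M) = 0"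
      then have char_K: "[n] \<cdot>\<^bsub>R Quot M\<^esub> \<one>\<^bsub>R Quot M\<^esub> \<noteq> \<zero>\<^bsub>R Quot M\<^esub>" if "0 < n" for n :: nat
        using ring_char_zeroD that by blast
      \<comment> \<open>Any prime would do in place of 2. Its inverse in the residue field lifts to
        \<open>R\<close> because the quotient map is onto.\<close>
      let ?t = "[(2::nat)] \<cdot>\<^bsub>R Quot M\<^esub> \<one>\<^bsub>R Quot M\<^esub>"
      have "?t \<noteq> \<zero>\<^bsub>R Quot M\<^esub>" using char_K[of 2] by simp
      then have inv: "inv\<^bsub>R Quot M\<^esub> ?t \<in> carrier (R Quot M)"
        "inv\<^bsub>R Quot M\<^esub> ?t \<otimes>\<^bsub>R Quot M\<^esub> ?t = \<one>\<^bsub>R Quot M\<^esub>"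
        using K.nonzero_inv[of ?t] by simp_all
      then obtain u where u: "u \<in> carrier R" "inv\<^bsub>R Quot M\<^esub> ?t = M +>\<^bsub>R\<^esub> u"
        unfolding FactRing_def A_RCOSETS_def' by auto
      have "submaximal R"
        by (rule submaximal_if_hom_to_field[OF is_cring K.field_axioms M.rcos_ring_hom _ two_is_prime_nat u(1)])
          (use char_K inv(2) u(2) in simp_all)
      then show False using assms(3) by blast
    qed
    then show ?thesis by (rule K.prime_ring_char)
  qed
  moreover have "\<exists>M. maximalideal M R \<and> ring_char (R Quot M) = p" if p: "Factorial_Ring.prime p" for p
  proof -
    let ?p = "[p] \<cdot>\<^bsub>R\<^esub> \<one>\<^bsub>R\<^esub>"
    have nonunit: "u \<otimes>\<^bsub>R\<^esub> ?p \<noteq> \<one>\<^bsub>R\<^esub>" if u: "u \<in> carrier R" for u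
    proof
      assume up: "u \<otimes>\<^bsub>R\<^esub> ?p = \<one>\<^bsub>R\<^esub>"
      then have "submaximal R"
        by (intro submaximal_if_prime_unit[OF _ p u]) (rule char)
      then show False using assms(3) by blast
    qed
    obtain M where M: "maximalideal M R" "?p \<in> M"
      using exists_maximalideal_mem[of ?p] nonunit by auto
    interpret M: maximalideal M R by fact
    interpret K: field "R Quot M" by (rule M.quotient_is_field[OF is_cring])
    interpret h: ring_hom_ring R "R Quot M" "\<lambda>x. M +>\<^bsub>R\<^esub> x" by (rule M.rcos_ring_hom_ring)
    have "[p] \<cdot>\<^bsub>R Quot M\<^esub> \<one>\<^bsub>R Quot M\<^esub> = \<zero>\<^bsub>R Quot M\<^esub>"
      using M.rcos_eq_zero_iff[of ?p] M(2) h.hom_add_pow_one[of p] by simp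
    then have "ring_char (R Quot M) = p" by (rule K.ring_char_eq_prime[OF p])
    then show ?thesis using M(1) by blast
  qed
  ultimately have eq: "{ring_char (R Quot M) | M. M \<in> max_ideals R} = {p :: nat. Factorial_Ring.prime p}"
    unfolding max_ideals_def by blast
  have "infinite (max_ideals R)"
  proof
    assume "finite (max_ideals R)"
    then have "finite ((\<lambda>M. ring_char (R Quot M)) ` max_ideals R)" by (rule finite_imageI)
    moreover have "(\<lambda>M. ring_char (R Quot M)) ` max_ideals R = {p :: nat. Factorial_Ring.prime p}"
      unfolding eq[symmetric] by blast
    ultimately show False using primes_infinite by simp
  qed
  with eq show ?thesis by blast
qed

end
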